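(* Let $H$ be the honeycomb graph with white vertices $w_{x,y}=(x-\tfrac14,y-\tfrac14)$ and black vertices $b_{x,y}=(x+\tfrac14,y+\tfrac14)$, $(x,y)\in\mathbb Z^2$, and straight edges $b_{x,y}w_{x,y}$, $b_{x,y}w_{x+1,y}$, $b_{x,y}w_{x,y+1}$. Let $A,B$ be real $2\times2$ invertible matrices and take the connection $\phi_{b_{x,y}w_{x,y}}=I$, $\phi_{b_{x,y}w_{x+1,y}}=A$, $\phi_{b_{x,y}w_{x,y+1}}=B$. Take cilia as follows: at $w_{x,y}$ the cilium is the wedge containing the upward direction $(0,1)$ (between the edges to $b_{x,y}$ and to $b_{x-1,y}$); at $b_{x,y}$ the cilium is the wedge containing the direction $(-1,0)$ (between the edges to $w_{x,y}$ and to $w_{x,y+1}$). Suppose that among the three matrices $A$, $B$, $AB^{-1}$, either exactly two have both eigenvalues real and positive and the third has both eigenvalues real and negative, or all three have both eigenvalues real and negative. Then for every finite subgraph $\mathcal H$ of $H$ with equally many black and white vertices, equipped with the restricted connection and the induced cilia (at each vertex, the wedge of $\mathcal H$ containing the same direction), every $2$-multiweb $m\in\Omega_{\mathbf 2}(\mathcal H)$ (multiplicity $n_v=2$ at all vertices) has $\mathrm{Tr}_\Phi(m)>0$.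
   Context: An $\mathbf n$-multiweb on a bipartite graph with multiplicities $n_v$ is a function $m:E\to\mathbb Z_{\ge0}$ with $\sum_{u\sim v}m_{uv}=n_v$ for every vertex $v$. The connection matrix $\phi_{bw}$ is viewed as a linear map $\mathbb R^{2}\to\mathbb R^{2}$ from the black to the white endpoint. The cilium at $v$ determines the "edge order" at $v$: at a black vertex, counterclockwise starting just after the cilium; at a white vertex, clockwise starting just after the cilium. Trace. Let $\mathcal C_v=\{1,\dots,n_v\}$. A coloring of $m$ assigns to each edge $e=bw$ with $m_e>0$ subsets $S_e\subset\mathcal C_b$, $T_e\subset\mathcal C_w$ of size $m_e$ such that at each black $b$ the sets $S_{bw}$ partition $\mathcal C_b$ and at each white $w$ the sets $T_{bw}$ partition $\mathcal C_w$. The sign $c_b$ is the signature of the permutation of $\mathcal C_b$ obtained by listing the sets $S_{bw}$ in the edge order at $b$, each in increasing order; $c_w$ is defined likewise with the sets $T_{bw}$ in the edge order at $w$. Then $\mathrm{Tr}_\Phi(m)=\sum_C\prod_v c_v\prod_{e=bw:\,m_e>0}\det[(\phi_{bw})_{T_e,S_e}]$, summing over colorings $C$, where $(\phi)_{T,S}$ is the submatrix with rows $T$ and columns $S$ in increasing order. *)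

theory Defs
  imports "HOL-Analysis.Analysis"
begin

text \<open>A finite bipartite graph is given by a set of black vertices Bv :: 'b set,
 white vertices Wv :: 'w set and edges E :: ('b \<times> 'w) set.
 The cilia are encoded by the induced edge orders: ordB b lists the white neighbours of b
 (counterclockwise starting just after the cilium), ordW w lists the black neighbours of w
 (clockwise starting just after the cilium).
 The connection phi b w is a matrix given by its entries (phi b w) i j, with row index i
 a colour of the white endpoint and column index j a colour of the black endpoint
 (colours are 1..n_v).\<close>

definition multiweb ::
  "'b set \<Rightarrow> 'w set \<Rightarrow> ('b \<times> 'w) set \<Rightarrow> ('b \<Rightarrow> nat) \<Rightarrow> ('w \<Rightarrow> nat) \<Rightarrow> ('b \<times> 'w \<Rightarrow> nat) \<Rightarrow> bool"
  where
  "multiweb Bv Wv E nB nW m \<longleftrightarrow>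
     (\<forall>e. e \<notin> E \<longrightarrow> m e = 0) \<and>
     (\<forall>b\<in>Bv. (\<Sum>w\<in>{w. (b, w) \<in> E}. m (b, w)) = nB b) \<and>
     (\<forall>w\<in>Wv. (\<Sum>b\<in>{b. (b, w) \<in> E}. m (b, w)) = nW w)"

definition coloring ::
  "'b set \<Rightarrow> 'w set \<Rightarrow> ('b \<times> 'w) set \<Rightarrow> ('b \<Rightarrow> nat) \<Rightarrow> ('w \<Rightarrow> nat) \<Rightarrow> ('b \<times> 'w \<Rightarrow> nat)
   \<Rightarrow> ('b \<times> 'w \<Rightarrow> nat set) \<Rightarrow> ('b \<times> 'w \<Rightarrow> nat set) \<Rightarrow> bool"
  where
  "coloring Bv Wv E nB nW m S T \<longleftrightarrow>
     (\<forall>e. (e \<notin> E \<or> m e = 0) \<longrightarrow> S e = {} \<and> T e = {}) \<and>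
     (\<forall>e\<in>E. m e > 0 \<longrightarrow>
        card (S e) = m e \<and> card (T e) = m e \<and>
        S e \<subseteq> {1..nB (fst e)} \<and> T e \<subseteq> {1..nW (snd e)}) \<and>
     (\<forall>b\<in>Bv. (\<Union>w\<in>{w. (b, w) \<in> E \<and> m (b, w) > 0}. S (b, w)) = {1..nB b} \<and>
        (\<forall>w w'. (b, w) \<in> E \<and> (b, w') \<in> E \<and> m (b, w) > 0 \<and> m (b, w') > 0 \<and> w \<noteq> w'
           \<longrightarrow> S (b, w) \<inter> S (b, w') = {})) \<and>
     (\<forall>w\<in>Wv. (\<Union>b\<in>{b. (b, w) \<in> E \<and> m (b, w) > 0}. T (b, w)) = {1..nW w} \<and>
        (\<forall>b b'. (b, w) \<in> E \<and> (b', w) \<in> E \<and> m (b, w) > 0 \<and> m (b', w) > 0 \<and> b \<noteq> b'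
           \<longrightarrow> T (b, w) \<inter> T (b', w) = {}))"

definition perm_of_list :: "nat list \<Rightarrow> nat \<Rightarrow> nat" where
  "perm_of_list L = (\<lambda>i. if 1 \<le> i \<and> i \<le> length L then L ! (i - 1) else i)"

definition sign_black ::
  "('b \<times> 'w) set \<Rightarrow> ('b \<Rightarrow> 'w list) \<Rightarrow> ('b \<times> 'w \<Rightarrow> nat) \<Rightarrow> ('b \<times> 'w \<Rightarrow> nat set) \<Rightarrow> 'b \<Rightarrow> int"
  where
  "sign_black E ordB m S b =
     sign (perm_of_list (concat (map (\<lambda>w. sorted_list_of_set (S (b, w)))
                                   (filter (\<lambda>w. (b, w) \<in> E \<and> m (b, w) > 0) (ordB b)))))"

definition sign_white ::
  "('b \<times> 'w) set \<Rightarrow> ('w \<Rightarrow> 'b list) \<Rightarrow> ('b \<times> 'w \<Rightarrow> nat) \<Rightarrow> ('b \<times> 'w \<Rightarrow> nat set) \<Rightarrow> 'w \<Rightarrow> int"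
  where
  "sign_white E ordW m T w =
     sign (perm_of_list (concat (map (\<lambda>b. sorted_list_of_set (T (b, w)))
                                   (filter (\<lambda>b. (b, w) \<in> E \<and> m (b, w) > 0) (ordW w)))))"

definition minor_det :: "(nat \<Rightarrow> nat \<Rightarrow> real) \<Rightarrow> nat set \<Rightarrow> nat set \<Rightarrow> real" where
  "minor_det M Tr Sc =
     (\<Sum>p\<in>{p. p permutes {..<card Tr}}.
        of_int (sign p) *
        (\<Prod>i<card Tr. M (sorted_list_of_set Tr ! i) (sorted_list_of_set Sc ! p i)))"

definition web_trace ::
  "'b set \<Rightarrow> 'w set \<Rightarrow> ('b \<times> 'w) set \<Rightarrow> ('b \<Rightarrow> nat) \<Rightarrow> ('w \<Rightarrow> nat)
   \<Rightarrow> ('b \<Rightarrow> 'w list) \<Rightarrow> ('w \<Rightarrow> 'b list) \<Rightarrow> ('b \<Rightarrow> 'w \<Rightarrow> nat \<Rightarrow> nat \<Rightarrow> real)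
   \<Rightarrow> ('b \<times> 'w \<Rightarrow> nat) \<Rightarrow> real"
  where
  "web_trace Bv Wv E nB nW ordB ordW phi m =
     (\<Sum>(S, T)\<in>{(S, T). coloring Bv Wv E nB nW m S T}.
        of_int ((\<Prod>b\<in>Bv. sign_black E ordB m S b) * (\<Prod>w\<in>Wv. sign_white E ordW m T w)) *
        (\<Prod>e\<in>{e\<in>E. m e > 0}. minor_det (phi (fst e) (snd e)) (T e) (S e)))"

text \<open>Black vertex b_{x,y} is represented by (x,y), white vertex w_{x,y} by (x,y).
 Edges: b_{x,y}w_{x,y}, b_{x,y}w_{x+1,y}, b_{x,y}w_{x,y+1}.\<close>
definition hc_edge :: "(int \<times> int) \<times> (int \<times> int) \<Rightarrow> bool" where
  "hc_edge e \<longleftrightarrow> (case e of ((x, y), w) \<Rightarrow> w = (x, y) \<or> w = (x + 1, y) \<or> w = (x, y + 1))"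

text \<open>Edge order at b_{x,y} (cilium in direction (-1,0), counterclockwise):
 directions 225, 315, 135 degrees, i.e. w_{x,y}, w_{x+1,y}, w_{x,y+1}.\<close>
definition hc_ordB :: "int \<times> int \<Rightarrow> (int \<times> int) list" where
  "hc_ordB b = (case b of (x, y) \<Rightarrow> [(x, y), (x + 1, y), (x, y + 1)])"

text \<open>Edge order at w_{x,y} (cilium in direction (0,1), clockwise):
 directions 45, 315, 135 degrees, i.e. b_{x,y}, b_{x,y-1}, b_{x-1,y}.\<close>
definition hc_ordW :: "int \<times> int \<Rightarrow> (int \<times> int) list" where
  "hc_ordW w = (case w of (x, y) \<Rightarrow> [(x, y), (x, y - 1), (x - 1, y)])"

definition entries :: "real^2^2 \<Rightarrow> nat \<Rightarrow> nat \<Rightarrow> real" where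
  "entries M i j = M $ (of_nat i) $ (of_nat j)"

definition hc_conn :: "real^2^2 \<Rightarrow> real^2^2 \<Rightarrow> int \<times> int \<Rightarrow> int \<times> int \<Rightarrow> nat \<Rightarrow> nat \<Rightarrow> real" where
  "hc_conn A B b w =
     (case b of (x, y) \<Rightarrow>
        if w = (x, y) then entries (mat 1) else
        if w = (x + 1, y) then entries A else
        if w = (x, y + 1) then entries B else (\<lambda>i j. 0))"

definition complex_eigenvalue :: "real^2^2 \<Rightarrow> complex \<Rightarrow> bool" where
  "complex_eigenvalue M l \<longleftrightarrow>
     (\<exists>v :: complex^2. v \<noteq> 0 \<and> (\<chi> i j. complex_of_real (M $ i $ j)) *v v = l *s v)"

definition eigs_real_pos :: "real^2^2 \<Rightarrow> bool" where
  "eigs_real_pos M \<longleftrightarrow> (\<forall>l. complex_eigenvalue M l \<longrightarrow> l \<in> \<real> \<and> Re l > 0)"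

definition eigs_real_neg :: "real^2^2 \<Rightarrow> bool" where
  "eigs_real_neg M \<longleftrightarrow> (\<forall>l. complex_eigenvalue M l \<longrightarrow> l \<in> \<real> \<and> Re l < 0)"

end

theory Submission
  imports Defs
begin

text \<open>
  Write \<open>\<phi>\<^sub>1 = I\<close>, \<open>\<phi>\<^sub>2 = A\<close>, \<open>\<phi>\<^sub>3 = B\<close>. Real eigenvectors of \<open>A\<close>, \<open>B\<close>, \<open>A B\<^sup>-\<^sup>1\<close> give vectors
  \<open>u\<^sub>1, u\<^sub>2, u\<^sub>3\<close> and \<open>w\<^sub>1, w\<^sub>2, w\<^sub>3\<close> such that \<open>\<phi>\<^sub>i u\<^sub>k\<close> is a multiple of \<open>w\<^sub>k\<close> whenever \<open>i \<noteq> k\<close>. The sign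
  condition makes the \<open>u\<^sub>k\<close> pairwise independent, so both triples can be scaled to have sum 0, and it
  forces the two triples to have opposite orientations. Thus every \<open>\<phi>\<^sub>i\<close> is, up to a sign \<open>\<nu>\<^sub>i\<close>, a sum of two
  rank-one matrices, and expanding each edge of multiplicity one accordingly turns the trace into a
  sum over states which factors over the vertices. With suitable signs all vertex factors have one
  and the same sign \<open>\<theta>\<close>, and these cancel because there are equally many black and white vertices.
  The signs \<open>\<nu>\<^sub>i\<close> cancel because every type of edge has even total multiplicity: the total displacement
  along the edges is twice the difference of the sums of white and of black positions.
  In particular no decomposition of the web into loops is needed.
\<close>

section \<open>Planar linear algebra\<close>

definition cross2 :: "real^2 \<Rightarrow> real^2 \<Rightarrow> real" where
  "cross2 x y = x$1 * y$2 - x$2 * y$1"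

lemma cross2_simps [simp]:
  "cross2 x x = 0"
  "cross2 (a *s x) y = a * cross2 x y"
  "cross2 x (a *s y) = a * cross2 x y"
  "cross2 (- x) y = - cross2 x y"
  "cross2 x (- y) = - cross2 x y"
  by (simp_all add: cross2_def algebra_simps)

lemma cross2_matrix_vector_mult: "cross2 (M *v x) (M *v y) = det M * cross2 x y"
  by (simp add: cross2_def det_2 matrix_vector_mult_def sum_2 algebra_simps)

text \<open>Cramer's rule in the plane. The coefficients are the scalings that later make a triple
  of pairwise independent vectors sum to 0.\<close>

lemma cross2_relation: "cross2 y z *s x + cross2 z x *s y + cross2 x y *s z = 0"
  by (simp add: cross2_def vec_eq_iff forall_2 algebra_simps)

lemma cross2_eq_0_imp_parallel:
  assumes "cross2 x y = 0" "x \<noteq> 0" "y \<noteq> 0"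
  obtains c where "c \<noteq> 0" "y = c *s x"
proof (cases "x$1 = 0")
  case True
  with assms have "x$2 \<noteq> 0" "y$1 = 0" by (auto simp: cross2_def vec_eq_iff forall_2)
  with True assms show thesis
    by (intro that[of "y$2 / x$2"]) (auto simp: vec_eq_iff forall_2)
next
  case False
  with assms have "y$2 = (y$1 / x$1) * x$2" by (simp add: cross2_def field_simps)
  with False assms show thesis
    by (intro that[of "y$1 / x$1"]) (auto simp: vec_eq_iff forall_2)
qed

text \<open>The field is general because a kernel vector is taken twice: over the complex numbers,
  to realise the roots of the characteristic polynomial as eigenvalues, and over the reals, to
  obtain a real eigenvector.\<close>

lemma singular_2x2_kernel:
  fixes a b c d :: "'a::field"
  assumes "a * d = b * c"
  obtains x y where "x \<noteq> 0 \<or> y \<noteq> 0" "a * x + b * y = 0" "c * x + d * y = 0"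
proof (cases "a = 0 \<and> b = 0")
  case True
  show thesis
  proof (cases "c = 0 \<and> d = 0")
    case True
    with \<open>a = 0 \<and> b = 0\<close> show thesis by (intro that[of 1 0]) auto
  next
    case False
    with \<open>a = 0 \<and> b = 0\<close> show thesis by (intro that[of d "- c"]) (auto simp: algebra_simps)
  qed
next
  case False
  with assms show thesis by (intro that[of "- b" a]) (auto simp: algebra_simps)
qed

section \<open>Sign conditions on the eigenvalues\<close>

definition eigs_signed :: "real \<Rightarrow> real^2^2 \<Rightarrow> bool" where
  "eigs_signed s M \<longleftrightarrow> det M > 0 \<and> (\<exists>l v. v \<noteq> 0 \<and> M *v v = l *s v) \<and>
     (\<forall>l v. v \<noteq> 0 \<longrightarrow> M *v v = l *s v \<longrightarrow> s * l > 0)"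

text \<open>The quadratic formula yields two complex eigenvalues, which are then real with the sign
  of \<open>s\<close>. Their product is \<open>det M\<close>, which is therefore positive, and
  either root has a real eigenvector. From here on only real data enter.\<close>

lemma eigs_signedI:
  assumes s: "s \<noteq> 0" and M: "\<And>l. complex_eigenvalue M l \<Longrightarrow> l \<in> \<real> \<and> s * Re l > 0"
  shows "eigs_signed s M"
proof -
  define t where "t = M$1$1 + M$2$2"
  define D where "D = det M"
  define q where "q = csqrt (complex_of_real (t\<^sup>2 - 4 * D))"
  have q2: "q * q = complex_of_real (t\<^sup>2 - 4 * D)"
    unfolding q_def by (metis power2_csqrt power2_eq_square)
  have root: "complex_eigenvalue M l"
    if "l = (of_real t + q) / 2 \<or> l = (of_real t - q) / 2" for l
  proof -
    have "2 * l - of_real t = q \<or> 2 * l - of_real t = - q"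
      using that by (auto simp: field_simps)
    then have "(2 * l - of_real t)\<^sup>2 = q * q"
      by (auto simp: power2_eq_square)
    then have "4 * (l * l - of_real t * l + of_real D) = 4 * 0"
      unfolding q2 by (simp add: power2_eq_square algebra_simps)
    then have "l * l - of_real t * l + of_real D = 0"
      by (subst (asm) mult_cancel_left) simp
    then have "(of_real (M$1$1) - l) * (of_real (M$2$2) - l) = of_real (M$1$2) * of_real (M$2$1)"
      by (simp add: D_def t_def det_2 algebra_simps)
    then obtain x y where "x \<noteq> 0 \<or> y \<noteq> 0" and
        "(of_real (M$1$1) - l) * x + of_real (M$1$2) * y = 0"
        "of_real (M$2$1) * x + (of_real (M$2$2) - l) * y = 0"
      by (rule singular_2x2_kernel)
    then show ?thesis
      unfolding complex_eigenvalue_def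
      by (intro exI[of _ "vector [x, y]"])
        (auto simp: vec_eq_iff forall_2 matrix_vector_mult_def sum_2 algebra_simps)
  qed
  define r1 r2 where "r1 = (of_real t + q) / 2" and "r2 = (of_real t - q) / 2"
  have r: "r1 \<in> \<real>" "s * Re r1 > 0" "r2 \<in> \<real>" "s * Re r2 > 0"
    using M root unfolding r1_def r2_def by blast+
  have "r1 * r2 = (of_real t * of_real t - q * q) / 4"
    by (simp add: r1_def r2_def field_simps)
  also have "\<dots> = of_real D"
    unfolding q2 by (simp add: power2_eq_square)
  finally have D: "r1 * r2 = of_real D" .
  obtain x1 x2 where x: "r1 = of_real x1" "r2 = of_real x2"
    using r by (auto elim!: Reals_cases)
  have D': "x1 * x2 = D"
    using D unfolding x by (metis of_real_eq_iff of_real_mult)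
  have "0 < (s * x1) * (s * x2)" using r x by simp
  also have "\<dots> = s\<^sup>2 * D" using D' by (simp add: power2_eq_square algebra_simps)
  finally have "D > 0" using s by (simp add: zero_less_mult_iff)
  moreover have "\<exists>l v. v \<noteq> 0 \<and> M *v v = l *s v"
  proof -
    \<comment> \<open>Sum and product of \<open>x1\<close> and \<open>x2\<close> are trace and
      determinant, so \<open>x1\<close> is a root of the characteristic polynomial over the
      reals.\<close>
    have "of_real (x1 + x2) = (of_real t :: complex)"
      using x by (simp add: r1_def r2_def flip: x) (simp add: field_simps)
    then have "x1 + x2 = t" by (simp only: of_real_eq_iff)
    with D' have "(M$1$1 - x1) * (M$2$2 - x1) = M$1$2 * M$2$1"
      unfolding D_def t_def det_2 by algebra
    then obtain x y where "x \<noteq> 0 \<or> y \<noteq> 0" and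
        "(M$1$1 - x1) * x + M$1$2 * y = 0" "M$2$1 * x + (M$2$2 - x1) * y = 0"
      by (rule singular_2x2_kernel)
    then show ?thesis
      by (intro exI[of _ x1] exI[of _ "vector [x, y]"])
        (auto simp: vec_eq_iff forall_2 matrix_vector_mult_def sum_2 algebra_simps)
  qed
  moreover have "s * l > 0" if v: "v \<noteq> 0" "M *v v = l *s v" for l v
  proof -
    have "complex_eigenvalue M (of_real l)"
      unfolding complex_eigenvalue_def
    proof (intro exI conjI)
      show "(\<chi> i. complex_of_real (v $ i)) \<noteq> 0"
        using v by (auto simp: vec_eq_iff)
      show "(\<chi> i j. complex_of_real (M $ i $ j)) *v (\<chi> i. complex_of_real (v $ i)) =
              complex_of_real l *s (\<chi> i. complex_of_real (v $ i))"
        using v(2) by (simp add: vec_eq_iff forall_2 matrix_vector_mult_def sum_2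
                          flip: of_real_mult of_real_add)
    qed
    from M[OF this] show ?thesis by simp
  qed
  ultimately show ?thesis unfolding eigs_signed_def D_def by blast
qed

lemma eigs_signed_of_pos: "eigs_real_pos M \<Longrightarrow> eigs_signed 1 M"
  by (rule eigs_signedI) (auto simp: eigs_real_pos_def)

lemma eigs_signed_of_neg: "eigs_real_neg M \<Longrightarrow> eigs_signed (-1) M"
  by (rule eigs_signedI) (auto simp: eigs_real_neg_def)

section \<open>Rank-one decomposition of the connection\<close>

datatype edge_type = TI | TA | TB

primrec conn :: "real^2^2 \<Rightarrow> real^2^2 \<Rightarrow> edge_type \<Rightarrow> real^2^2" where
  "conn A B TI = mat 1"
| "conn A B TA = A"
| "conn A B TB = B"

text \<open>The row vector of the linear form sending x to \<open>cross2 x u\<close>; this form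
  vanishes on \<open>u\<close>.\<close>

definition covec :: "real^2 \<Rightarrow> real^2" where
  "covec u = vector [u$2, - u$1]"

lemma cross2_covec [simp]: "cross2 (covec u) (covec v) = cross2 u v"
  by (simp add: cross2_def covec_def algebra_simps)

text \<open>The values on the basis \<open>p\<close>, \<open>q\<close> determine \<open>M\<close>:
  it is \<open>d\<close> times w (x) covec q minus \<open>d'\<close> times w' (x) covec p, divided
  by \<open>cross2 p q\<close>. Opposite signs of \<open>d\<close> and \<open>d'\<close> turn this
  difference into one overall sign times a combination with positive weights.\<close>

lemma matrix_expand:
  assumes p: "M *v p = d *s w" and q: "M *v q = d' *s w'"
    and dd: "d * d' < 0" and pq: "cross2 p q \<noteq> 0"
  shows "M $ r $ c = sgn d * sgn (cross2 p q) *
           (\<bar>d\<bar> / \<bar>cross2 p q\<bar> * w $ r * covec q $ c + \<bar>d'\<bar> / \<bar>cross2 p q\<bar> * w' $ r * covec p $ c)"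
proof -
  have "M$r$1 * p$1 + M$r$2 * p$2 = d * w $ r" "M$r$1 * q$1 + M$r$2 * q$2 = d' * w' $ r"
    using arg_cong[OF p, of "\<lambda>v. v $ r"] arg_cong[OF q, of "\<lambda>v. v $ r"]
    by (simp_all add: matrix_vector_mult_def sum_2)
  then have "cross2 p q * M$r$1 = d * w $ r * q$2 - d' * w' $ r * p$2"
      "cross2 p q * M$r$2 = - d * w $ r * q$1 + d' * w' $ r * p$1"
    unfolding cross2_def by algebra+
  then have "cross2 p q * M$r$c = d * w $ r * covec q $ c - d' * w' $ r * covec p $ c"
    using exhaust_2[of c] by (auto simp: covec_def)
  then have "M$r$c = (d * w $ r * covec q $ c - d' * w' $ r * covec p $ c) / cross2 p q"
    using pq by (simp add: field_simps)
  moreover have "(0 < d \<and> d' < 0) \<or> (d < 0 \<and> 0 < d')"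
    using dd by (auto simp: mult_less_0_iff)
  moreover have "cross2 p q < 0 \<or> cross2 p q > 0" using pq by auto
  ultimately show ?thesis
    by (auto simp: field_simps)
qed

text \<open>The cilia order the edges as \<open>TI\<close>, \<open>TA\<close>, \<open>TB\<close> at
  a black vertex and as \<open>TI\<close>, \<open>TB\<close>, \<open>TA\<close> at a white one; the
  pairs list an earlier type before a later one.\<close>

definition black_pairs :: "(edge_type \<times> edge_type) set" where
  "black_pairs = {(TI, TA), (TI, TB), (TA, TB)}"

definition white_pairs :: "(edge_type \<times> edge_type) set" where
  "white_pairs = {(TI, TB), (TI, TA), (TB, TA)}"

text \<open>For i, j, k cyclically ordered, the two rank-one terms of the connection on an edge of type i
  are, up to sign, \<open>w\<^sub>j \<otimes> covec u\<^sub>k\<close> and \<open>w\<^sub>k \<otimes> covec u\<^sub>j\<close>.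
  The signs are chosen such that every cross product occurring at a vertex has the same sign.\<close>
lemma conn_factorization_of_triples:
  assumes u: "uI + uA + uB = 0" and w: "wI + wA + wB = 0"
    and IA: "mat 1 *v uA = dIA *s wA" and IB: "mat 1 *v uB = dIB *s wB"
    and AB: "A *v uB = dAB *s wB" and AI: "A *v uI = dAI *s wI"
    and BI: "B *v uI = dBI *s wI" and BA: "B *v uA = dBA *s wA"
    and neg: "dIA * dIB < 0" "dAB * dAI < 0" "dBI * dBA < 0"
    and orient: "cross2 uI uA * cross2 wI wA < 0"
  obtains \<theta> \<nu> X Y where
    "\<theta> = 1 \<or> \<theta> = (-1::real)" "\<And>i. \<nu> i = 1 \<or> \<nu> i = (-1::real)"
    "\<And>i r c. conn A B i $ r $ c = \<nu> i * (\<Sum>k\<in>UNIV. X i k $ r * Y i k $ c)"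
    "\<And>i j k l. (i, j) \<in> black_pairs \<Longrightarrow> \<theta> * cross2 (Y i k) (Y j l) \<ge> 0"
    "\<And>i j. (i, j) \<in> black_pairs \<Longrightarrow> \<theta> * cross2 (Y i True) (Y j True) > 0"
    "\<And>i j k l. (i, j) \<in> white_pairs \<Longrightarrow> \<theta> * cross2 (X i k) (X j l) \<ge> 0"
    "\<And>i j. (i, j) \<in> white_pairs \<Longrightarrow> \<theta> * cross2 (X i True) (X j True) > 0"
proof -
  define \<delta> \<epsilon> where "\<delta> = cross2 uI uA" and "\<epsilon> = cross2 wI wA"
  have uB: "uB = - uI - uA" and wB: "wB = - wI - wA"
    using u w by (simp_all add: algebra_simps eq_neg_iff_add_eq_0)
  \<comment> \<open>Since each triple sums to 0, its three cyclic cross products coincide, so every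
    orientation is governed by a single number.\<close>
  have cu: "cross2 uI uA = \<delta>" "cross2 uA uB = \<delta>" "cross2 uB uI = \<delta>"
      "cross2 uA uI = - \<delta>" "cross2 uB uA = - \<delta>" "cross2 uI uB = - \<delta>"
    by (simp_all add: \<delta>_def uB cross2_def algebra_simps)
  have cw: "cross2 wI wA = \<epsilon>" "cross2 wA wB = \<epsilon>" "cross2 wB wI = \<epsilon>"
      "cross2 wA wI = - \<epsilon>" "cross2 wB wA = - \<epsilon>" "cross2 wI wB = - \<epsilon>"
    by (simp_all add: \<epsilon>_def wB cross2_def algebra_simps)
  have \<delta>\<epsilon>: "\<delta> \<noteq> 0" "\<epsilon> \<noteq> 0" "\<delta> * \<epsilon> < 0" using orient by (auto simp: \<delta>_def \<epsilon>_def)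
  have d0: "dIA \<noteq> 0" "dIB \<noteq> 0" "dAB \<noteq> 0" "dAI \<noteq> 0" "dBI \<noteq> 0" "dBA \<noteq> 0"
    using neg by auto
  \<comment> \<open>The positive weights of \<open>matrix_expand\<close> go into \<open>X\<close>.
    For each type, the signs put on \<open>X\<close> and \<open>Y\<close> have the same product in
    both terms, + for \<open>TI\<close> and - for \<open>TA\<close> and \<open>TB\<close>;
    \<open>\<nu>\<close> absorbs it.\<close>
  define X where "X i k = (case i of
      TI \<Rightarrow> (if k then (\<bar>dIA\<bar> / \<bar>\<delta>\<bar>) *s wA else - (\<bar>dIB\<bar> / \<bar>\<delta>\<bar>) *s wB)
    | TA \<Rightarrow> (if k then (\<bar>dAB\<bar> / \<bar>\<delta>\<bar>) *s wB else - (\<bar>dAI\<bar> / \<bar>\<delta>\<bar>) *s wI)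
    | TB \<Rightarrow> (if k then - (\<bar>dBI\<bar> / \<bar>\<delta>\<bar>) *s wI else (\<bar>dBA\<bar> / \<bar>\<delta>\<bar>) *s wA))" for i k
  define Y where "Y i k = (case i of
      TI \<Rightarrow> (if k then covec uB else (-1) *s covec uA)
    | TA \<Rightarrow> (if k then (-1) *s covec uI else covec uB)
    | TB \<Rightarrow> (if k then covec uA else (-1) *s covec uI))" for i k
  define \<nu> where "\<nu> i = (case i of
      TI \<Rightarrow> sgn dIA * sgn \<delta> | TA \<Rightarrow> - sgn dAB * sgn \<delta> | TB \<Rightarrow> - sgn dBI * sgn \<delta>)" for i
  \<comment> \<open>At black vertices the cross products are 0 or \<open>- \<delta>\<close>, at
    white ones nonnegative multiples of \<open>\<epsilon>\<close>. As \<open>\<delta>\<close> and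
    \<open>\<epsilon>\<close> have opposite signs, \<open>sgn \<epsilon>\<close> corrects both. The
    index \<open>True\<close> selects different vectors of the triple for the three types, which
    gives strictness.\<close>
  show thesis
  proof (rule that[of "sgn \<epsilon>" \<nu> X Y])
    show "sgn \<epsilon> = 1 \<or> sgn \<epsilon> = -1" using \<delta>\<epsilon> by (auto simp: sgn_if)
    show "\<nu> i = 1 \<or> \<nu> i = -1" for i
      using \<delta>\<epsilon> d0 by (auto simp: \<nu>_def sgn_if split: edge_type.split)
    show "conn A B i $ r $ c = \<nu> i * (\<Sum>k\<in>UNIV. X i k $ r * Y i k $ c)" for i r c
    proof (cases i)
      case TI
      then show ?thesis
        using matrix_expand[OF IA IB neg(1), unfolded cu, OF \<delta>\<epsilon>(1), of r c]
        by (simp add: X_def Y_def \<nu>_def UNIV_bool algebra_simps)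
    next
      case TA
      then show ?thesis
        using matrix_expand[OF AB AI neg(2), unfolded cu, OF \<delta>\<epsilon>(1), of r c]
        by (simp add: X_def Y_def \<nu>_def UNIV_bool algebra_simps)
    next
      case TB
      then show ?thesis
        using matrix_expand[OF BI BA neg(3), unfolded cu, OF \<delta>\<epsilon>(1), of r c]
        by (simp add: X_def Y_def \<nu>_def UNIV_bool algebra_simps)
    qed
    have s\<epsilon>: "sgn \<epsilon> * \<epsilon> > 0" "sgn \<epsilon> * \<delta> < 0"
      using \<delta>\<epsilon> by (auto simp: sgn_if mult_less_0_iff)
    show "(i, j) \<in> black_pairs \<Longrightarrow> sgn \<epsilon> * cross2 (Y i k) (Y j l) \<ge> 0" for i j k l
      using s\<epsilon> by (auto simp: black_pairs_def Y_def cu)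
    show "(i, j) \<in> black_pairs \<Longrightarrow> sgn \<epsilon> * cross2 (Y i True) (Y j True) > 0" for i j
      using s\<epsilon> by (auto simp: black_pairs_def Y_def cu)
    have abs_eps: "sgn \<epsilon> * \<epsilon> = \<bar>\<epsilon>\<bar>" by (auto simp: sgn_if)
    show "(i, j) \<in> white_pairs \<Longrightarrow> sgn \<epsilon> * cross2 (X i k) (X j l) \<ge> 0" for i j k l
      using abs_eps by (auto simp: white_pairs_def X_def cw mult.left_commute[of "sgn \<epsilon>"])
    show "(i, j) \<in> white_pairs \<Longrightarrow> sgn \<epsilon> * cross2 (X i True) (X j True) > 0" for i j
      using abs_eps \<delta>\<epsilon> d0
      by (auto simp: white_pairs_def X_def cw mult.left_commute[of "sgn \<epsilon>"],
          auto simp: zero_less_divide_iff zero_less_mult_iff)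
  qed
qed

text \<open>Each vector is named after the type it leaves out: I and A send \<open>uB\<close> to one
  line, I and B send \<open>uA\<close> to one line, A and B send \<open>uI\<close> to one line. The
  sign of the product of the eigenvalues yields independence, and with the positive determinants it
  yields the orientation.\<close>

lemma conn_factorization:
  assumes invB: "invertible B"
    and A: "eigs_signed sA A" and B: "eigs_signed sB B" and C: "eigs_signed sC (A ** matrix_inv B)"
    and s: "sA * sB * sC < 0"
  obtains \<theta> \<nu> X Y where
    "\<theta> = 1 \<or> \<theta> = (-1::real)" "\<And>i. \<nu> i = 1 \<or> \<nu> i = (-1::real)"
    "\<And>i r c. conn A B i $ r $ c = \<nu> i * (\<Sum>k\<in>UNIV. X i k $ r * Y i k $ c)"
    "\<And>i j k l. (i, j) \<in> black_pairs \<Longrightarrow> \<theta> * cross2 (Y i k) (Y j l) \<ge> 0"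
    "\<And>i j. (i, j) \<in> black_pairs \<Longrightarrow> \<theta> * cross2 (Y i True) (Y j True) > 0"
    "\<And>i j k l. (i, j) \<in> white_pairs \<Longrightarrow> \<theta> * cross2 (X i k) (X j l) \<ge> 0"
    "\<And>i j. (i, j) \<in> white_pairs \<Longrightarrow> \<theta> * cross2 (X i True) (X j True) > 0"
proof -
  obtain lB uB where uB: "uB \<noteq> 0" "A *v uB = lB *s uB"
    using A by (auto simp: eigs_signed_def)
  obtain lA uA where uA: "uA \<noteq> 0" "B *v uA = lA *s uA"
    using B by (auto simp: eigs_signed_def)
  obtain lI wI where wI: "wI \<noteq> 0" "(A ** matrix_inv B) *v wI = lI *s wI"
    using C by (auto simp: eigs_signed_def)
  define uI where "uI = matrix_inv B *v wI"
  have BuI: "B *v uI = wI" and inv_B: "matrix_inv B *v (B *v x) = x" for x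
    unfolding uI_def
    using someI_ex[OF invB[unfolded invertible_def]]
    by (simp_all add: matrix_vector_mul_assoc matrix_inv_def)
  have AuI: "A *v uI = lI *s wI"
    using wI(2) by (simp add: uI_def matrix_vector_mul_assoc)
  have uI0: "uI \<noteq> 0" using BuI wI(1) by auto
  have sgnA: "sA * l > 0" if "v \<noteq> 0" "A *v v = l *s v" for l v
    using A that by (auto simp: eigs_signed_def)
  have sgnB: "sB * l > 0" if "v \<noteq> 0" "B *v v = l *s v" for l v
    using B that by (auto simp: eigs_signed_def)
  \<comment> \<open>If A v = l B v, then B v is an eigenvector of A B^-1 for l.\<close>
  have sgnC: "sC * l > 0" if "v \<noteq> 0" "A *v v = l *s (B *v v)" for l v
  proof -
    have "B *v v \<noteq> 0" using inv_B[of v] that(1) by auto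
    moreover have "(A ** matrix_inv B) *v (B *v v) = l *s (B *v v)"
      using that(2) by (simp add: inv_B flip: matrix_vector_mul_assoc)
    ultimately show ?thesis using C by (auto simp: eigs_signed_def)
  qed
  have l: "sA * lB > 0" "sB * lA > 0" "sC * lI > 0"
    using sgnA[OF uB] sgnB[OF uA] sgnC[OF uI0] AuI BuI by auto
  have l0: "lA \<noteq> 0" "lB \<noteq> 0" "lI \<noteq> 0" using l by auto
  have "0 < (sA * lB) * (sB * lA) * (sC * lI)" using l by simp
  also have "\<dots> = (sA * sB * sC) * (lA * lB * lI)" by (simp add: algebra_simps)
  finally have lneg: "lA * lB * lI < 0"
    using s zero_less_mult_iff[of "sA * sB * sC"] by auto
  \<comment> \<open>A common eigenvector of A and B would give A B^-1 an eigenvalue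
    \<open>lB / lA\<close> with the sign of \<open>lI\<close>, hence a positive product of the three
    eigenvalues. The other two parallel cases fail in the same way.\<close>
  have AB0: "cross2 uA uB \<noteq> 0"
  proof
    assume "cross2 uA uB = 0"
    then obtain c where c: "c \<noteq> 0" "uB = c *s uA"
      using uA uB cross2_eq_0_imp_parallel by metis
    have "A *v uB = (lB / lA) *s (B *v uB)"
      using uA uB l0 c by (simp add: vector_scalar_commute vector_smult_assoc)
    from sgnC[OF uB(1) this] have "sC * (lB / lA) > 0" .
    with l lneg show False
      by (auto simp: zero_less_mult_iff mult_less_0_iff zero_less_divide_iff)
  qed
  have IA0: "cross2 uI uA \<noteq> 0"
  proof
    assume "cross2 uI uA = 0"
    then obtain c where c: "c \<noteq> 0" "uA = c *s uI"
      using uA uI0 cross2_eq_0_imp_parallel by metis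
    have "A *v uA = lI *s (B *v uA)"
      by (simp add: c(2) AuI BuI vector_scalar_commute vector_smult_assoc mult.commute)
    then have "A *v uA = (lI * lA) *s uA" by (simp add: uA vector_smult_assoc)
    from sgnA[OF uA(1) this] have "sA * (lI * lA) > 0" .
    with l lneg show False
      by (auto simp: zero_less_mult_iff mult_less_0_iff)
  qed
  have BI0: "cross2 uB uI \<noteq> 0"
  proof
    assume "cross2 uB uI = 0"
    then obtain c where c: "c \<noteq> 0" "uI = c *s uB"
      using uB uI0 cross2_eq_0_imp_parallel by metis
    have "lI *s (B *v uI) = lB *s uI"
      using AuI BuI c uB by (simp add: vector_scalar_commute vector_smult_assoc mult.commute)
    then have "B *v uI = (lB / lI) *s uI"
      using l0 by (metis divide_inverse_commute left_inverse vector_smult_assoc vector_smult_lid)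
    from sgnB[OF uI0 this] have "sB * (lB / lI) > 0" .
    with l lneg show False
      by (auto simp: zero_less_mult_iff mult_less_0_iff zero_less_divide_iff)
  qed
  have det: "det A > 0" "det B > 0" using A B by (auto simp: eigs_signed_def)
  \<comment> \<open>B maps \<open>uI\<close>, \<open>uA\<close> to \<open>wI\<close>,
    \<open>lA *s uA\<close>, and A maps \<open>uB\<close>, \<open>uI\<close> to
    \<open>lB *s uB\<close>, \<open>lI *s wI\<close>. As both determinants are positive, this
    compares the orientations of the triples (uI, uA, uB) and (wI, uA, uB).\<close>
  have "cross2 wI (lA *s uA) = det B * cross2 uI uA"
    by (metis BuI uA(2) cross2_matrix_vector_mult)
  then have wIA: "lA * cross2 wI uA = det B * cross2 uI uA" by simp
  have "cross2 (lB *s uB) (lI *s wI) = det A * cross2 uB uI"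
    by (metis AuI uB(2) cross2_matrix_vector_mult)
  then have wBI: "lB * lI * cross2 uB wI = det A * cross2 uB uI" by (simp add: ac_simps)
  \<comment> \<open>These are the coefficients of \<open>cross2_relation\<close> for (uI, uA, uB)
    and (wI, uA, uB). After rescaling, I multiplies the second and third vectors by \<open>y\<close>
    and \<open>z\<close>.\<close>
  define \<alpha>I \<alpha>A \<alpha>B where "\<alpha>I = cross2 uA uB" and "\<alpha>A = cross2 uB uI" and "\<alpha>B = cross2 uI uA"
  define \<beta>I \<beta>A \<beta>B where "\<beta>I = cross2 uA uB" and "\<beta>A = cross2 uB wI" and "\<beta>B = cross2 wI uA"
  have nz: "\<alpha>I \<noteq> 0" "\<alpha>A \<noteq> 0" "\<alpha>B \<noteq> 0" "\<beta>I \<noteq> 0" "\<beta>A \<noteq> 0" "\<beta>B \<noteq> 0"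
    using AB0 IA0 BI0 wIA wBI det by (auto simp: \<alpha>I_def \<alpha>A_def \<alpha>B_def \<beta>I_def \<beta>A_def \<beta>B_def)
  define y z where "y = \<alpha>A / \<beta>A" and "z = \<alpha>B / \<beta>B"
  define \<delta> \<epsilon> where "\<delta> = cross2 (\<alpha>I *s uI) (\<alpha>A *s uA)" and "\<epsilon> = cross2 (\<beta>I *s wI) (\<beta>A *s uA)"
  have \<delta>: "\<delta> = \<alpha>I * \<alpha>A * \<alpha>B" and \<epsilon>: "\<epsilon> = \<beta>I * \<beta>A * \<beta>B"
    by (simp_all add: \<delta>_def \<epsilon>_def \<alpha>B_def \<beta>B_def)
  \<comment> \<open>The two scalars of each connection (\<open>y\<close>, \<open>z\<close> for I;
    \<open>lB * z\<close>, \<open>lI\<close> for A; 1, \<open>lA * y\<close> for B) have a product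
    with the sign of \<open>\<delta> * \<epsilon>\<close>: what remains is a square, times a
    determinant for A and B.\<close>
  have yz: "y * z * (\<delta> * \<epsilon>) > 0"
  proof -
    have "y * z * (\<delta> * \<epsilon>) = (\<alpha>I * \<alpha>A * \<alpha>B)\<^sup>2"
      using nz by (simp add: y_def z_def \<delta> \<epsilon> power2_eq_square field_simps) (simp add: \<alpha>I_def \<beta>I_def)
    then show ?thesis using nz by simp
  qed
  have AI: "lB * lI * z * (\<delta> * \<epsilon>) > 0"
  proof -
    have "lB * lI * z * (\<delta> * \<epsilon>) = (\<alpha>B * \<alpha>I)\<^sup>2 * \<alpha>A * (lB * lI * \<beta>A)"
      using nz by (simp add: z_def \<delta> \<epsilon> power2_eq_square field_simps) (simp add: \<alpha>I_def \<beta>I_def)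
    also have "lB * lI * \<beta>A = det A * \<alpha>A" using wBI by (simp add: \<beta>A_def \<alpha>A_def)
    also have "(\<alpha>B * \<alpha>I)\<^sup>2 * \<alpha>A * (det A * \<alpha>A) = (\<alpha>B * \<alpha>I * \<alpha>A)\<^sup>2 * det A"
      by (simp add: power2_eq_square algebra_simps)
    finally show ?thesis using nz det by simp
  qed
  have BA: "lA * y * (\<delta> * \<epsilon>) > 0"
  proof -
    have "lA * y * (\<delta> * \<epsilon>) = (\<alpha>A * \<alpha>I)\<^sup>2 * \<alpha>B * (lA * \<beta>B)"
      using nz by (simp add: y_def \<delta> \<epsilon> power2_eq_square field_simps) (simp add: \<alpha>I_def \<beta>I_def)
    also have "lA * \<beta>B = det B * \<alpha>B" using wIA by (simp add: \<beta>B_def \<alpha>B_def)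
    also have "(\<alpha>A * \<alpha>I)\<^sup>2 * \<alpha>B * (det B * \<alpha>B) = (\<alpha>B * \<alpha>I * \<alpha>A)\<^sup>2 * det B"
      by (simp add: power2_eq_square algebra_simps)
    finally show ?thesis using nz det by simp
  qed
  \<comment> \<open>Otherwise all three products are positive; multiplied together they give
    \<open>lA * lB * lI\<close> times the square of \<open>y * z\<close>, contradicting
    \<open>lneg\<close>. The same sign then makes each of the three products negative.\<close>
  have \<delta>\<epsilon>: "\<delta> * \<epsilon> < 0"
  proof (rule ccontr)
    assume "\<not> \<delta> * \<epsilon> < 0"
    with yz AI BA have "y * z > 0" "lB * lI * z > 0" "lA * y > 0"
      using zero_less_mult_iff[of _ "\<delta> * \<epsilon>"] by auto
    with lneg show False
      by (auto simp: zero_less_mult_iff mult_less_0_iff)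
  qed
  have "a < 0" if "a * (\<delta> * \<epsilon>) > 0" for a
    using that \<delta>\<epsilon> zero_less_mult_iff[of a "\<delta> * \<epsilon>"] by linarith
  from this[OF yz] this[OF AI] this[OF BA]
  have neg: "y * z < 0" "lB * z * lI < 0" "lA * y < 0"
    by (simp_all only: mult.assoc mult.commute[of z lI])
  show thesis
  proof (rule conn_factorization_of_triples[of "\<alpha>I *s uI" "\<alpha>A *s uA" "\<alpha>B *s uB"
          "\<beta>I *s wI" "\<beta>A *s uA" "\<beta>B *s uB" y z A "lB * z" lI B 1 "lA * y"])
    show "\<alpha>I *s uI + \<alpha>A *s uA + \<alpha>B *s uB = 0" "\<beta>I *s wI + \<beta>A *s uA + \<beta>B *s uB = 0"
      unfolding \<alpha>I_def \<alpha>A_def \<alpha>B_def \<beta>I_def \<beta>A_def \<beta>B_def by (rule cross2_relation)+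
    show "mat 1 *v (\<alpha>A *s uA) = y *s (\<beta>A *s uA)" "mat 1 *v (\<alpha>B *s uB) = z *s (\<beta>B *s uB)"
      "A *v (\<alpha>B *s uB) = (lB * z) *s (\<beta>B *s uB)" "A *v (\<alpha>I *s uI) = lI *s (\<beta>I *s wI)"
      "B *v (\<alpha>I *s uI) = 1 *s (\<beta>I *s wI)" "B *v (\<alpha>A *s uA) = (lA * y) *s (\<beta>A *s uA)"
      using nz
      by (simp_all add: y_def z_def vector_scalar_commute vector_smult_assoc uA uB AuI BuI
          \<alpha>I_def \<beta>I_def mult.commute)
    show "y * z < 0" "lB * z * lI < 0" "1 * (lA * y) < 0" using neg by simp_all
    show "cross2 (\<alpha>I *s uI) (\<alpha>A *s uA) * cross2 (\<beta>I *s wI) (\<beta>A *s uA) < 0"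
      using \<delta>\<epsilon> unfolding \<delta>_def \<epsilon>_def .
  qed (rule that; assumption)
qed

section \<open>Colorings at one side of the bipartition\<close>

lemma perm_of_list_12: "perm_of_list [1, 2] = id"
proof
  fix i :: nat
  show "perm_of_list [1, 2] i = id i"
    by (cases "i = 1 \<or> i = 2") (auto simp: perm_of_list_def)
qed

lemma perm_of_list_21: "perm_of_list [2, 1] = Transposition.transpose 1 2"
proof
  fix i :: nat
  show "perm_of_list [2, 1] i = Transposition.transpose 1 2 i"
    by (cases "i = 1 \<or> i = 2") (auto simp: perm_of_list_def transpose_def)
qed

lemma sign_perm_of_list [simp]:
  "sign (perm_of_list [Suc 0, 2]) = 1"
  "sign (perm_of_list [2, Suc 0]) = -1"
  using perm_of_list_12 perm_of_list_21 by (simp_all add: sign_id sign_swap_id)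

lemma minor_det_singleton: "minor_det M {t} {s} = M t s"
  by (simp add: minor_det_def lessThan_Suc)

lemma minor_det_full:
  "minor_det M {1, 2} {1, 2} = M 1 1 * M 2 2 - M 1 2 * M 2 1"
proof -
  have eq: "{..<card {1, 2 :: nat}} = {0, 1}" by auto
  have perms: "{p. p permutes {0, 1 :: nat}} = {id, Transposition.transpose 0 1}"
    by (auto simp: permutes_doubleton_iff)
  have "id \<noteq> Transposition.transpose 0 (1 :: nat)"
    by (metis id_apply transpose_apply_first zero_neq_one)
  then show ?thesis
    unfolding minor_det_def eq perms by (simp add: sign_swap_id)
qed

text \<open>One side of a coloring with two colours, for abstract vertices and edges, so that it
  serves black vertices with the sets S and white vertices with the sets T. \<open>L v\<close> is
  meant to list the edges at \<open>v\<close> in the edge order.\<close>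

definition half_coloring :: "'v set \<Rightarrow> ('v \<Rightarrow> 'e list) \<Rightarrow> ('e \<Rightarrow> nat) \<Rightarrow> ('e \<Rightarrow> nat set) \<Rightarrow> bool" where
  "half_coloring V L m S \<longleftrightarrow>
     (\<forall>e. e \<notin> (\<Union>v\<in>V. set (L v)) \<longrightarrow> S e = {}) \<and>
     (\<forall>v\<in>V. (\<forall>e\<in>set (L v). card (S e) = m e \<and> S e \<subseteq> {1..2}) \<and>
        (\<Union>e\<in>set (L v). S e) = {1..2} \<and>
        (\<forall>e\<in>set (L v). \<forall>f\<in>set (L v). e \<noteq> f \<longrightarrow> S e \<inter> S f = {}))"

definition list_sign :: "('e \<Rightarrow> nat set) \<Rightarrow> 'e list \<Rightarrow> int" where
  "list_sign S es = sign (perm_of_list (concat (map (\<lambda>e. sorted_list_of_set (S e)) es)))"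

text \<open>The signed sum over the colorings at one vertex of a weight that is a product over
  edges: a double edge takes both colours, and two simple edges give a 2 by 2 determinant.\<close>

fun local_sum :: "('e \<Rightarrow> nat set \<Rightarrow> real) \<Rightarrow> 'e list \<Rightarrow> real" where
  "local_sum F [e] = F e {1, 2}"
| "local_sum F [e, f] = F e {1} * F f {2} - F e {2} * F f {1}"
| "local_sum F _ = 0"

definition two_valent :: "('e \<Rightarrow> nat) \<Rightarrow> 'e list \<Rightarrow> bool" where
  "two_valent m es \<longleftrightarrow> (\<exists>e. es = [e] \<and> m e = 2) \<or> (\<exists>e f. es = [e, f] \<and> e \<noteq> f \<and> m e = 1 \<and> m f = 1)"

lemma two_valentI:
  assumes "distinct es" "\<forall>e\<in>set es. m e > 0" "sum m (set es) = 2"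
  shows "two_valent m es"
proof (cases es)
  case Nil
  with assms show ?thesis by simp
next
  case (Cons e es')
  show ?thesis
  proof (cases es')
    case Nil
    with assms Cons show ?thesis by (simp add: two_valent_def)
  next
    case (Cons f es'')
    with \<open>es = e # es'\<close> assms have "m e + (m f + sum m (set es'')) = 2" "m e > 0" "m f > 0"
        and es'': "\<forall>e\<in>set es''. m e > 0" "e \<noteq> f"
      by auto
    then have "m e = 1" "m f = 1" "sum m (set es'') = 0" by linarith+
    moreover from this es'' have "es'' = []" by (cases es'') auto
    ultimately show ?thesis
      using \<open>es = e # es'\<close> Cons es'' by (simp add: two_valent_def)
  qed
qed

lemma two_singletons:
  fixes P Q :: "nat set"
  assumes "card P = 1" "card Q = 1" "P \<union> Q = {1..2}"
  shows "P = {1} \<and> Q = {2} \<or> P = {2} \<and> Q = {1}"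
proof -
  obtain a b where "P = {a}" "Q = {b}" using assms by (auto simp: card_1_singleton_iff)
  moreover have "{1..2} = {1, 2 :: nat}" by auto
  ultimately show ?thesis using assms(3) by (auto simp: doubleton_eq_iff insert_commute)
qed

lemma half_coloring_cases:
  assumes "half_coloring V L m S" "v \<in> V" "two_valent m (L v)"
  obtains e where "L v = [e]" "m e = 2" "S e = {1, 2}"
  | e f where "L v = [e, f]" "e \<noteq> f" "m e = 1" "m f = 1" "S e = {1}" "S f = {2}"
  | e f where "L v = [e, f]" "e \<noteq> f" "m e = 1" "m f = 1" "S e = {2}" "S f = {1}"
proof -
  have S: "\<forall>e\<in>set (L v). card (S e) = m e" "(\<Union>e\<in>set (L v). S e) = {1..2}"
    using assms(1,2) by (auto simp: half_coloring_def)
  from assms(3) consider e where "L v = [e]" "m e = 2"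
    | e f where "L v = [e, f]" "e \<noteq> f" "m e = 1" "m f = 1"
    by (auto simp: two_valent_def)
  then show thesis
  proof cases
    case 1
    with S have "S e = {1..2}" by simp
    also have "\<dots> = {1, 2}" by auto
    finally show ?thesis using 1 that(1) by blast
  next
    case 2
    with S two_singletons[of "S e" "S f"] show ?thesis using that(2,3) by auto
  qed
qed

text \<open>By \<open>own\<close>, the edge sets at different vertices are disjoint, so a half
  coloring is an independent choice at every vertex and the sum factors over the vertices.\<close>

lemma sum_half_colorings:
  fixes F :: "'e \<Rightarrow> nat set \<Rightarrow> real"
  assumes fin: "finite V"
    and own: "\<And>v e. v \<in> V \<Longrightarrow> e \<in> set (L v) \<Longrightarrow> own e = v"
    and val: "\<And>v. v \<in> V \<Longrightarrow> two_valent m (L v)"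
  shows "(\<Sum>S | half_coloring V L m S.
            of_int (\<Prod>v\<in>V. list_sign S (L v)) * (\<Prod>e\<in>(\<Union>v\<in>V. set (L v)). F e (S e))) =
         (\<Prod>v\<in>V. local_sum F (L v))"
proof -
  \<comment> \<open>A double edge leaves one option, \<open>True\<close>; at two simple edges,
    \<open>True\<close> means that the first edge gets colour 1. \<open>G\<close> is the signed
    weight of an option.\<close>
  define C where "C v = (if length (L v) = 1 then {True} else UNIV)" for v
  define G where "G v c = (if length (L v) = 1 then F (hd (L v)) {1, 2}
      else if c then F (hd (L v)) {1} * F (L v ! 1) {2}
      else - (F (hd (L v)) {2} * F (L v ! 1) {1}))" for v c
  define col where "col p e = (if own e \<in> V \<and> e \<in> set (L (own e)) then
       (if m e = 2 then {1, 2 :: nat} else if (e = hd (L (own e))) = p (own e) then {1} else {2})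
       else {})" for p e
  \<comment> \<open>Testing against {2} instead of {1} also sends the full set {1, 2} on a double
    edge to \<open>True\<close>.\<close>
  define choice where "choice S = (\<lambda>v\<in>V. S (hd (L v)) \<noteq> {2 :: nat})" for S
  have loc: "local_sum F (L v) = (\<Sum>c\<in>C v. G v c)" if "v \<in> V" for v
    using val[OF that] by (auto simp: two_valent_def C_def G_def UNIV_bool)
  have "(\<Prod>v\<in>V. local_sum F (L v)) = (\<Prod>v\<in>V. \<Sum>c\<in>C v. G v c)"
    using loc by (rule prod.cong[OF refl])
  also have "\<dots> = (\<Sum>p\<in>PiE V C. \<Prod>v\<in>V. G v (p v))"
    using fin by (intro prod_sum_PiE) (auto simp: C_def)
  finally have rhs: "(\<Prod>v\<in>V. local_sum F (L v)) = (\<Sum>p\<in>PiE V C. \<Prod>v\<in>V. G v (p v))" .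
  show ?thesis
    unfolding rhs
  proof (rule sum.reindex_bij_witness[where j = choice and i = col])
    fix S assume "S \<in> {S. half_coloring V L m S}"
    then have S: "half_coloring V L m S" by simp
    show "col (choice S) = S"
    proof
      fix e
      show "col (choice S) e = S e"
      proof (cases "own e \<in> V \<and> e \<in> set (L (own e))")
        case True
        then have v: "own e \<in> V" and e: "e \<in> set (L (own e))" by auto
        from S v val[OF v] show ?thesis
          by (cases rule: half_coloring_cases) (use v e in \<open>auto simp: col_def choice_def\<close>)
      next
        case False
        then have "e \<notin> (\<Union>v\<in>V. set (L v))" using own by auto
        with S have "S e = {}" unfolding half_coloring_def by blast
        with False show ?thesis by (auto simp: col_def)
      qed
    qed
    show "choice S \<in> PiE V C"
    proof (rule PiE_I)
      fix v assume v: "v \<in> V"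
      from S v val[OF v] show "choice S v \<in> C v"
        by (cases rule: half_coloring_cases) (use v in \<open>auto simp: C_def choice_def\<close>)
    qed (simp add: choice_def)
    have "(\<Prod>e\<in>(\<Union>v\<in>V. set (L v)). F e (S e)) = (\<Prod>v\<in>V. \<Prod>e\<in>set (L v). F e (S e))"
      using fin own by (intro prod.UNION_disjoint) auto
    then have "of_int (\<Prod>v\<in>V. list_sign S (L v)) * (\<Prod>e\<in>(\<Union>v\<in>V. set (L v)). F e (S e)) =
        (\<Prod>v\<in>V. of_int (list_sign S (L v)) * (\<Prod>e\<in>set (L v). F e (S e)))"
      by (simp add: prod.distrib)
    also have "\<dots> = (\<Prod>v\<in>V. G v (choice S v))"
    proof (rule prod.cong[OF refl])
      fix v assume v: "v \<in> V"
      from S v val[OF v]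
      show "of_int (list_sign S (L v)) * (\<Prod>e\<in>set (L v). F e (S e)) = G v (choice S v)"
        by (cases rule: half_coloring_cases) (use v in \<open>auto simp: list_sign_def G_def choice_def\<close>)
    qed
    finally show "(\<Prod>v\<in>V. G v (choice S v)) =
      of_int (\<Prod>v\<in>V. list_sign S (L v)) * (\<Prod>e\<in>(\<Union>v\<in>V. set (L v)). F e (S e))" by simp
  next
    fix p assume p: "p \<in> PiE V C"
    show "choice (col p) = p"
    proof
      fix v
      show "choice (col p) v = p v"
      proof (cases "v \<in> V")
        case True
        with p have "p v \<in> C v" by auto
        with True val[OF True] own[OF True] show ?thesis
          by (auto simp: choice_def col_def two_valent_def C_def)
      next
        case False
        then show ?thesis by (simp add: choice_def PiE_arb[OF p])
      qed
    qed
    have at_V: "(\<forall>e\<in>set (L v). card (col p e) = m e \<and> col p e \<subseteq> {1..2}) \<and>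
        (\<Union>e\<in>set (L v). col p e) = {1..2} \<and>
        (\<forall>e\<in>set (L v). \<forall>f\<in>set (L v). e \<noteq> f \<longrightarrow> col p e \<inter> col p f = {})"
      if v: "v \<in> V" for v
    proof -
      have i12: "{1..2} = {1, 2 :: nat}" by auto
      consider e where "L v = [e]" "m e = 2" "col p e = {1, 2}"
        | e f where "L v = [e, f]" "m e = 1" "m f = 1"
            "col p e = {1} \<and> col p f = {2} \<or> col p e = {2} \<and> col p f = {1}"
      proof -
        from val[OF v] consider e where "L v = [e]" "m e = 2"
          | e f where "L v = [e, f]" "e \<noteq> f" "m e = 1" "m f = 1"
          by (auto simp: two_valent_def)
        then show thesis
        proof cases
          case 1
          with own[OF v, of e] v show ?thesis by (intro that(1)) (auto simp: col_def)
        next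
          case 2
          then have "own e = v" "own f = v" using own[OF v] by auto
          with 2 v show ?thesis by (intro that(2)[of e f]) (auto simp: col_def)
        qed
      qed
      then show ?thesis unfolding i12 by cases auto
    qed
    have off_V: "col p e = {}" if "e \<notin> (\<Union>v\<in>V. set (L v))" for e
      using that by (auto simp: col_def)
    have "half_coloring V L m (col p)"
      unfolding half_coloring_def by (rule conjI[OF allI[OF impI[OF off_V]] ballI[OF at_V]])
    then show "col p \<in> {S. half_coloring V L m S}" by simp
  qed
qed

section \<open>Webs in the honeycomb graph\<close>

text \<open>Expanding the product over edges gives a sum over states \<open>\<kappa>\<close> that
  select one rank-one term per edge. For a fixed state, the dependence on S and on T
  separates.\<close>

lemma sum_prod_bilinear:
  fixes f :: "'e \<Rightarrow> 't \<Rightarrow> 's \<Rightarrow> real"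
  assumes fin: "finite D" "\<And>e. e \<in> D \<Longrightarrow> finite (K e)"
    and f: "\<And>S T e. S \<in> SS \<Longrightarrow> T \<in> TT \<Longrightarrow> e \<in> D \<Longrightarrow>
        f e (T e) (S e) = n e * (\<Sum>k\<in>K e. X e k (T e) * Y e k (S e))"
  shows "(\<Sum>S\<in>SS. \<Sum>T\<in>TT. a S * b T * (\<Prod>e\<in>D. f e (T e) (S e))) =
    (\<Prod>e\<in>D. n e) * (\<Sum>\<kappa>\<in>PiE D K. (\<Sum>S\<in>SS. a S * (\<Prod>e\<in>D. Y e (\<kappa> e) (S e))) *
                                  (\<Sum>T\<in>TT. b T * (\<Prod>e\<in>D. X e (\<kappa> e) (T e))))"
proof -
  have "(\<Sum>S\<in>SS. \<Sum>T\<in>TT. a S * b T * (\<Prod>e\<in>D. f e (T e) (S e))) =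
      (\<Sum>S\<in>SS. \<Sum>T\<in>TT. \<Sum>\<kappa>\<in>PiE D K. (\<Prod>e\<in>D. n e) *
        ((a S * (\<Prod>e\<in>D. Y e (\<kappa> e) (S e))) * (b T * (\<Prod>e\<in>D. X e (\<kappa> e) (T e)))))"
  proof (intro sum.cong refl)
    fix S T assume ST: "S \<in> SS" "T \<in> TT"
    have "(\<Prod>e\<in>D. f e (T e) (S e)) = (\<Prod>e\<in>D. n e) * (\<Prod>e\<in>D. \<Sum>k\<in>K e. X e k (T e) * Y e k (S e))"
      using f[OF ST] by (simp add: prod.distrib)
    also have "(\<Prod>e\<in>D. \<Sum>k\<in>K e. X e k (T e) * Y e k (S e)) =
        (\<Sum>\<kappa>\<in>PiE D K. \<Prod>e\<in>D. X e (\<kappa> e) (T e) * Y e (\<kappa> e) (S e))"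
      using fin by (rule prod_sum_PiE)
    finally show "a S * b T * (\<Prod>e\<in>D. f e (T e) (S e)) =
      (\<Sum>\<kappa>\<in>PiE D K. (\<Prod>e\<in>D. n e) *
        ((a S * (\<Prod>e\<in>D. Y e (\<kappa> e) (S e))) * (b T * (\<Prod>e\<in>D. X e (\<kappa> e) (T e)))))"
      by (simp add: prod.distrib sum_distrib_left mult_ac)
  qed
  also have "\<dots> = (\<Sum>S\<in>SS. \<Sum>\<kappa>\<in>PiE D K. \<Sum>T\<in>TT. (\<Prod>e\<in>D. n e) *
        ((a S * (\<Prod>e\<in>D. Y e (\<kappa> e) (S e))) * (b T * (\<Prod>e\<in>D. X e (\<kappa> e) (T e)))))"
    by (intro sum.cong refl sum.swap)
  also have "\<dots> = (\<Sum>\<kappa>\<in>PiE D K. \<Sum>S\<in>SS. \<Sum>T\<in>TT. (\<Prod>e\<in>D. n e) *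
        ((a S * (\<Prod>e\<in>D. Y e (\<kappa> e) (S e))) * (b T * (\<Prod>e\<in>D. X e (\<kappa> e) (T e)))))"
    by (rule sum.swap)
  finally have eq: "(\<Sum>S\<in>SS. \<Sum>T\<in>TT. a S * b T * (\<Prod>e\<in>D. f e (T e) (S e))) = \<dots>" .
  show ?thesis
    unfolding eq by (simp only: sum_product) (simp only: sum_distrib_left)
qed

definition etype :: "(int \<times> int) \<times> (int \<times> int) \<Rightarrow> edge_type" where
  "etype e = (if snd e = fst e then TI else if snd (snd e) = snd (fst e) then TA else TB)"

lemma hc_conn_etype:
  "hc_edge e \<Longrightarrow> hc_conn A B (fst e) (snd e) = entries (conn A B (etype e))"
  by (auto simp: hc_edge_def hc_conn_def etype_def)

lemma hc_edge_iff: "hc_edge (b, w) \<longleftrightarrow> w \<in> set (hc_ordB b)" "hc_edge (b, w) \<longleftrightarrow> b \<in> set (hc_ordW w)"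
  by (cases b; cases w; auto simp: hc_edge_def hc_ordB_def hc_ordW_def)+

text \<open>Translates disjointness over the edges at a vertex, as in \<open>half_coloring\<close>,
  into disjointness over its neighbours, as in \<open>coloring\<close>.\<close>

lemma ball_fst_fibre:
  fixes D :: "('b \<times> 'w) set"
  shows "(\<forall>e\<in>{e \<in> D. fst e = b}. \<forall>f\<in>{e \<in> D. fst e = b}. e \<noteq> f \<longrightarrow> P e f) \<longleftrightarrow>
    (\<forall>w w'. (b, w) \<in> D \<and> (b, w') \<in> D \<and> w \<noteq> w' \<longrightarrow> P (b, w) (b, w'))"
  by auto

lemma ball_snd_fibre:
  fixes D :: "('b \<times> 'w) set"
  shows "(\<forall>e\<in>{e \<in> D. snd e = w}. \<forall>f\<in>{e \<in> D. snd e = w}. e \<noteq> f \<longrightarrow> P e f) \<longleftrightarrow>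
    (\<forall>b b'. (b, w) \<in> D \<and> (b', w) \<in> D \<and> b \<noteq> b' \<longrightarrow> P (b, w) (b', w))"
  by auto

lemma etype_displacement:
  assumes "hc_edge e"
  shows "fst (snd e) - fst (fst e) = of_bool (etype e = TA)"
    "snd (snd e) - snd (fst e) = of_bool (etype e = TB)"
  using assms by (auto simp: hc_edge_def etype_def)

section \<open>Local structure and parity of a 2-multiweb\<close>

locale honeycomb_web =
  fixes Bs Ws :: "(int \<times> int) set" and E and m :: "(int \<times> int) \<times> (int \<times> int) \<Rightarrow> nat"
  assumes finB: "finite Bs" and finW: "finite Ws" and balanced: "card Bs = card Ws"
    and E: "E \<subseteq> {e. hc_edge e \<and> fst e \<in> Bs \<and> snd e \<in> Ws}"
    and web: "multiweb Bs Ws E (\<lambda>_. 2) (\<lambda>_. 2) m"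
begin

definition D :: "((int \<times> int) \<times> (int \<times> int)) set" where
  "D = {e \<in> E. m e > 0}"

text \<open>Keeps the order and the filter of \<open>sign_black\<close>, so that the signs agree by
  unfolding.\<close>

definition atB :: "int \<times> int \<Rightarrow> ((int \<times> int) \<times> (int \<times> int)) list" where
  "atB b = map (\<lambda>w. (b, w)) (filter (\<lambda>w. (b, w) \<in> E \<and> m (b, w) > 0) (hc_ordB b))"

definition atW :: "int \<times> int \<Rightarrow> ((int \<times> int) \<times> (int \<times> int)) list" where
  "atW w = map (\<lambda>b. (b, w)) (filter (\<lambda>b. (b, w) \<in> E \<and> m (b, w) > 0) (hc_ordW w))"

lemma finE: "finite E"
  by (rule finite_subset[of _ "Bs \<times> Ws"]) (use E finB finW in auto)

lemma finD: "finite D"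
  using finE by (simp add: D_def)

lemma D_edge: "e \<in> D \<Longrightarrow> hc_edge e" "e \<in> D \<Longrightarrow> fst e \<in> Bs" "e \<in> D \<Longrightarrow> snd e \<in> Ws"
  using E by (auto simp: D_def)

lemma D_pos: "e \<in> D \<Longrightarrow> m e > 0"
  by (simp add: D_def)

lemma E_ord: "(b, w) \<in> E \<Longrightarrow> w \<in> set (hc_ordB b)" "(b, w) \<in> E \<Longrightarrow> b \<in> set (hc_ordW w)"
  using E hc_edge_iff by blast+

lemma set_atB: "set (atB b) = {e \<in> D. fst e = b}"
  using E_ord(1) by (force simp: atB_def D_def)

lemma set_atW: "set (atW w) = {e \<in> D. snd e = w}"
  using E_ord(2) by (force simp: atW_def D_def)

lemma UN_atB: "(\<Union>b\<in>Bs. set (atB b)) = D"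
  using D_edge by (auto simp: set_atB)

lemma UN_atW: "(\<Union>w\<in>Ws. set (atW w)) = D"
  using D_edge by (auto simp: set_atW)

lemma distinct_at: "distinct (atB b)" "distinct (atW w)"
  by (cases b; cases w; simp add: atB_def atW_def hc_ordB_def hc_ordW_def)+

lemma sum_atB: "b \<in> Bs \<Longrightarrow> sum m {e \<in> D. fst e = b} = 2"
proof -
  assume b: "b \<in> Bs"
  have "sum m {e \<in> D. fst e = b} = sum m {e \<in> E. fst e = b}"
    using finE by (intro sum.mono_neutral_left) (auto simp: D_def)
  also have "\<dots> = (\<Sum>w\<in>{w. (b, w) \<in> E}. m (b, w))"
    by (rule sum.reindex_bij_witness[where j = snd and i = "Pair b"]) auto
  finally show ?thesis using web b by (simp add: multiweb_def)
qed

lemma sum_atW: "w \<in> Ws \<Longrightarrow> sum m {e \<in> D. snd e = w} = 2"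
proof -
  assume w: "w \<in> Ws"
  have "sum m {e \<in> D. snd e = w} = sum m {e \<in> E. snd e = w}"
    using finE by (intro sum.mono_neutral_left) (auto simp: D_def)
  also have "\<dots> = (\<Sum>b\<in>{b. (b, w) \<in> E}. m (b, w))"
    by (rule sum.reindex_bij_witness[where j = fst and i = "\<lambda>b. (b, w)"]) auto
  finally show ?thesis using web w by (simp add: multiweb_def)
qed

lemma two_valent_atB: "b \<in> Bs \<Longrightarrow> two_valent m (atB b)"
  by (rule two_valentI) (simp_all add: distinct_at set_atB sum_atB D_pos)

lemma two_valent_atW: "w \<in> Ws \<Longrightarrow> two_valent m (atW w)"
  by (rule two_valentI) (simp_all add: distinct_at set_atW sum_atW D_pos)

lemma atB_pair: "atB b = [e, f] \<Longrightarrow> (etype e, etype f) \<in> black_pairs"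
  by (cases b) (auto simp: atB_def hc_ordB_def black_pairs_def etype_def split: if_splits)

lemma atW_pair: "atW w = [e, f] \<Longrightarrow> (etype e, etype f) \<in> white_pairs"
  by (cases w) (auto simp: atW_def hc_ordW_def white_pairs_def etype_def split: if_splits)

text \<open>The displacements of the edges, counted with multiplicity, sum to twice the difference of the
  white and the black positions; hence every edge type has even total multiplicity.\<close>
lemma even_displacement:
  fixes g :: "int \<times> int \<Rightarrow> int"
  shows "even (\<Sum>e\<in>D. int (m e) * (g (snd e) - g (fst e)))"
proof -
  have "(\<Sum>e\<in>D. int (m e) * g (snd e)) = (\<Sum>w\<in>Ws. \<Sum>e\<in>{e \<in> D. snd e = w}. int (m e) * g (snd e))"
    using finD finW D_edge by (intro sum.group[symmetric]) auto
  also have "\<dots> = (\<Sum>w\<in>Ws. int (sum m {e \<in> D. snd e = w}) * g w)"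
    by (intro sum.cong refl) (simp add: sum_distrib_right)
  also have "\<dots> = (\<Sum>w\<in>Ws. 2 * g w)"
    by (intro sum.cong refl) (simp add: sum_atW del: of_nat_sum)
  finally have W: "even (\<Sum>e\<in>D. int (m e) * g (snd e))" by (simp add: dvd_sum)
  have "(\<Sum>e\<in>D. int (m e) * g (fst e)) = (\<Sum>b\<in>Bs. \<Sum>e\<in>{e \<in> D. fst e = b}. int (m e) * g (fst e))"
    using finD finB D_edge by (intro sum.group[symmetric]) auto
  also have "\<dots> = (\<Sum>b\<in>Bs. int (sum m {e \<in> D. fst e = b}) * g b)"
    by (intro sum.cong refl) (simp add: sum_distrib_right)
  also have "\<dots> = (\<Sum>b\<in>Bs. 2 * g b)"
    by (intro sum.cong refl) (simp add: sum_atB del: of_nat_sum)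
  finally have B: "even (\<Sum>e\<in>D. int (m e) * g (fst e))" by (simp add: dvd_sum)
  from W B show ?thesis by (simp add: right_diff_distrib sum_subtractf)
qed

lemma even_total: "even (sum m D)"
proof -
  have "sum m D = (\<Sum>b\<in>Bs. sum m {e \<in> D. fst e = b})"
    using finD finB D_edge by (intro sum.group[symmetric]) auto
  also have "\<dots> = (\<Sum>b\<in>Bs. 2)" by (intro sum.cong refl sum_atB)
  finally show ?thesis by simp
qed

text \<open>The first coordinate of the displacement counts the edges of type \<open>TA\<close>, the
  second those of type \<open>TB\<close>; type \<open>TI\<close> follows from the even
  total.\<close>

lemma even_type: "even (sum m {e \<in> D. etype e = i})"
proof -
  have sum_of_bool: "(\<Sum>e\<in>D. int (m e) * of_bool (etype e = j)) = int (sum m {e \<in> D. etype e = j})" for j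
  proof -
    have "int (sum m {e \<in> D. etype e = j}) = (\<Sum>e\<in>{e \<in> D. etype e = j}. int (m e) * of_bool (etype e = j))"
      by simp
    also have "\<dots> = (\<Sum>e\<in>D. int (m e) * of_bool (etype e = j))"
      using finD by (intro sum.mono_neutral_left) auto
    finally show ?thesis by simp
  qed
  have eqA: "(\<Sum>e\<in>D. int (m e) * of_bool (etype e = TA)) = (\<Sum>e\<in>D. int (m e) * (fst (snd e) - fst (fst e)))"
    by (intro sum.cong refl) (simp only: etype_displacement D_edge)
  have "even (int (sum m {e \<in> D. etype e = TA}))"
    unfolding sum_of_bool[symmetric] eqA by (rule even_displacement)
  then have A: "even (sum m {e \<in> D. etype e = TA})" by (simp only: even_of_nat)
  have eqB: "(\<Sum>e\<in>D. int (m e) * of_bool (etype e = TB)) = (\<Sum>e\<in>D. int (m e) * (snd (snd e) - snd (fst e)))"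
    by (intro sum.cong refl) (simp only: etype_displacement D_edge)
  have "even (int (sum m {e \<in> D. etype e = TB}))"
    unfolding sum_of_bool[symmetric] eqB by (rule even_displacement)
  then have B: "even (sum m {e \<in> D. etype e = TB})" by (simp only: even_of_nat)
  have "D = {e \<in> D. etype e = TI} \<union> ({e \<in> D. etype e = TA} \<union> {e \<in> D. etype e = TB})"
    using edge_type.exhaust by blast
  then have "sum m D = sum m ({e \<in> D. etype e = TI} \<union> ({e \<in> D. etype e = TA} \<union> {e \<in> D. etype e = TB}))"
    by simp
  also have "\<dots> = sum m {e \<in> D. etype e = TI} +
      (sum m {e \<in> D. etype e = TA} + sum m {e \<in> D. etype e = TB})"
    using finD by (subst sum.union_disjoint; (subst sum.union_disjoint)?) auto
  finally have "even (sum m {e \<in> D. etype e = TI})" using A B even_total by auto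
  with A B show ?thesis by (cases i) auto
qed

lemma prod_type_signs:
  fixes \<nu> :: "edge_type \<Rightarrow> real"
  assumes "\<And>i. \<nu> i = 1 \<or> \<nu> i = -1"
  shows "(\<Prod>e\<in>D. \<nu> (etype e) ^ m e) = 1"
proof -
  have U: "(UNIV :: edge_type set) = {TI, TA, TB}" using edge_type.exhaust by blast
  have "(\<Prod>e\<in>D. \<nu> (etype e) ^ m e) = (\<Prod>i\<in>UNIV. \<Prod>e\<in>{e \<in> D. etype e = i}. \<nu> (etype e) ^ m e)"
    by (rule prod.group[symmetric, OF finD _ subset_UNIV]) (simp add: U)
  also have "\<dots> = (\<Prod>i\<in>UNIV. \<nu> i ^ sum m {e \<in> D. etype e = i})"
    by (intro prod.cong refl) (simp add: power_sum)
  also have "\<dots> = 1"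
  proof (rule prod.neutral, rule ballI)
    fix i
    show "\<nu> i ^ sum m {e \<in> D. etype e = i} = 1"
      using assms[of i] even_type[of i] by auto
  qed
  finally show ?thesis .
qed

section \<open>Separation of colorings into black and white halves\<close>

lemma half_coloring_atB_iff:
  "half_coloring Bs atB m S \<longleftrightarrow>
     (\<forall>e. (e \<notin> E \<or> m e = 0) \<longrightarrow> S e = {}) \<and>
     (\<forall>e\<in>E. m e > 0 \<longrightarrow> card (S e) = m e \<and> S e \<subseteq> {1..2}) \<and>
     (\<forall>b\<in>Bs. (\<Union>w\<in>{w. (b, w) \<in> E \<and> m (b, w) > 0}. S (b, w)) = {1..2} \<and>
        (\<forall>w w'. (b, w) \<in> E \<and> (b, w') \<in> E \<and> m (b, w) > 0 \<and> m (b, w') > 0 \<and> w \<noteq> w'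
           \<longrightarrow> S (b, w) \<inter> S (b, w') = {}))"
proof -
  have D: "e \<notin> D \<longleftrightarrow> e \<notin> E \<or> m e = 0" for e by (auto simp: D_def)
  have U: "(\<Union>e\<in>{e \<in> D. fst e = b}. S e) = (\<Union>w\<in>{w. (b, w) \<in> E \<and> m (b, w) > 0}. S (b, w))" for b
    by (auto simp: D_def)
  have X: "(\<forall>e\<in>{e \<in> D. fst e = b}. \<forall>f\<in>{e \<in> D. fst e = b}. e \<noteq> f \<longrightarrow> S e \<inter> S f = {}) \<longleftrightarrow>
      (\<forall>w w'. (b, w) \<in> E \<and> (b, w') \<in> E \<and> m (b, w) > 0 \<and> m (b, w') > 0 \<and> w \<noteq> w'
           \<longrightarrow> S (b, w) \<inter> S (b, w') = {})" for b
    unfolding ball_fst_fibre D_def by blast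
  have C: "(\<forall>b\<in>Bs. \<forall>e\<in>{e \<in> D. fst e = b}. card (S e) = m e \<and> S e \<subseteq> {1..2}) \<longleftrightarrow>
      (\<forall>e\<in>E. m e > 0 \<longrightarrow> card (S e) = m e \<and> S e \<subseteq> {1..2})"
    using E unfolding D_def by blast
  have split: "(a \<and> (\<forall>v\<in>V. P v \<and> Q v \<and> R v)) = (a \<and> (\<forall>v\<in>V. P v) \<and> (\<forall>v\<in>V. Q v \<and> R v))"
    for a V and P Q R :: "int \<times> int \<Rightarrow> bool" by blast
  show ?thesis
    unfolding half_coloring_def UN_atB
    unfolding set_atB U X D C[symmetric] by (rule split)
qed

lemma half_coloring_atW_iff:
  "half_coloring Ws atW m T \<longleftrightarrow>
     (\<forall>e. (e \<notin> E \<or> m e = 0) \<longrightarrow> T e = {}) \<and>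
     (\<forall>e\<in>E. m e > 0 \<longrightarrow> card (T e) = m e \<and> T e \<subseteq> {1..2}) \<and>
     (\<forall>w\<in>Ws. (\<Union>b\<in>{b. (b, w) \<in> E \<and> m (b, w) > 0}. T (b, w)) = {1..2} \<and>
        (\<forall>b b'. (b, w) \<in> E \<and> (b', w) \<in> E \<and> m (b, w) > 0 \<and> m (b', w) > 0 \<and> b \<noteq> b'
           \<longrightarrow> T (b, w) \<inter> T (b', w) = {}))"
proof -
  have D: "e \<notin> D \<longleftrightarrow> e \<notin> E \<or> m e = 0" for e by (auto simp: D_def)
  have U: "(\<Union>e\<in>{e \<in> D. snd e = w}. T e) = (\<Union>b\<in>{b. (b, w) \<in> E \<and> m (b, w) > 0}. T (b, w))" for w
    by (auto simp: D_def)
  have X: "(\<forall>e\<in>{e \<in> D. snd e = w}. \<forall>f\<in>{e \<in> D. snd e = w}. e \<noteq> f \<longrightarrow> T e \<inter> T f = {}) \<longleftrightarrow>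
      (\<forall>b b'. (b, w) \<in> E \<and> (b', w) \<in> E \<and> m (b, w) > 0 \<and> m (b', w) > 0 \<and> b \<noteq> b'
           \<longrightarrow> T (b, w) \<inter> T (b', w) = {})" for w
    unfolding ball_snd_fibre D_def by blast
  have C: "(\<forall>w\<in>Ws. \<forall>e\<in>{e \<in> D. snd e = w}. card (T e) = m e \<and> T e \<subseteq> {1..2}) \<longleftrightarrow>
      (\<forall>e\<in>E. m e > 0 \<longrightarrow> card (T e) = m e \<and> T e \<subseteq> {1..2})"
    using E unfolding D_def by blast
  have split: "(a \<and> (\<forall>v\<in>V. P v \<and> Q v \<and> R v)) = (a \<and> (\<forall>v\<in>V. P v) \<and> (\<forall>v\<in>V. Q v \<and> R v))"
    for a V and P Q R :: "int \<times> int \<Rightarrow> bool" by blast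
  show ?thesis
    unfolding half_coloring_def UN_atW
    unfolding set_atW U X D C[symmetric] by (rule split)
qed

text \<open>No clause of \<open>coloring\<close> relates S to T beyond the common multiplicities, so
  the sum over colorings becomes a double sum over half colorings.\<close>

lemma coloring_iff:
  "coloring Bs Ws E (\<lambda>_. 2) (\<lambda>_. 2) m S T \<longleftrightarrow>
     half_coloring Bs atB m S \<and> half_coloring Ws atW m T"
proof -
  have off: "(\<forall>e. (e \<notin> E \<or> m e = 0) \<longrightarrow> S e = {} \<and> T e = {}) \<longleftrightarrow>
      (\<forall>e. (e \<notin> E \<or> m e = 0) \<longrightarrow> S e = {}) \<and> (\<forall>e. (e \<notin> E \<or> m e = 0) \<longrightarrow> T e = {})"
    by blast
  have on: "(\<forall>e\<in>E. m e > 0 \<longrightarrow> card (S e) = m e \<and> card (T e) = m e \<and> S e \<subseteq> {1..2} \<and> T e \<subseteq> {1..2}) \<longleftrightarrow>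
      (\<forall>e\<in>E. m e > 0 \<longrightarrow> card (S e) = m e \<and> S e \<subseteq> {1..2}) \<and>
      (\<forall>e\<in>E. m e > 0 \<longrightarrow> card (T e) = m e \<and> T e \<subseteq> {1..2})"
    by blast
  show ?thesis
    unfolding half_coloring_atB_iff half_coloring_atW_iff coloring_def off on
    by (rule iffI; elim conjE; intro conjI; assumption)
qed

lemma sign_black_eq: "sign_black E hc_ordB m S b = list_sign S (atB b)"
  by (simp add: sign_black_def list_sign_def atB_def o_def)

lemma sign_white_eq: "sign_white E hc_ordW m T w = list_sign T (atW w)"
  by (simp add: sign_white_def list_sign_def atW_def o_def)

lemma web_trace_eq:
  "web_trace Bs Ws E (\<lambda>_. 2) (\<lambda>_. 2) hc_ordB hc_ordW (hc_conn A B) m =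
    (\<Sum>S | half_coloring Bs atB m S. \<Sum>T | half_coloring Ws atW m T.
       of_int (\<Prod>b\<in>Bs. list_sign S (atB b)) * of_int (\<Prod>w\<in>Ws. list_sign T (atW w)) *
       (\<Prod>e\<in>D. minor_det (entries (conn A B (etype e))) (T e) (S e)))"
proof -
  have "{(S, T). coloring Bs Ws E (\<lambda>_. 2) (\<lambda>_. 2) m S T} =
      {S. half_coloring Bs atB m S} \<times> {T. half_coloring Ws atW m T}"
    by (auto simp: coloring_iff)
  moreover have "(\<Prod>e\<in>{e \<in> E. m e > 0}. minor_det (hc_conn A B (fst e) (snd e)) (T e) (S e)) =
      (\<Prod>e\<in>D. minor_det (entries (conn A B (etype e))) (T e) (S e))" for S T
    unfolding D_def[symmetric] using D_edge by (intro prod.cong refl) (simp add: hc_conn_etype)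
  ultimately show ?thesis
    unfolding web_trace_def sign_black_eq sign_white_eq by (simp add: sum.cartesian_product)
qed

text \<open>Both endpoints see the same multiplicity, so the only minors that occur are full
  determinants and single entries.\<close>

lemma half_coloring_at_D:
  assumes "half_coloring Bs atB m S" "half_coloring Ws atW m T" "e \<in> D"
  obtains "m e = 2" "S e = {1, 2}" "T e = {1, 2}"
  | s t where "m e = 1" "S e = {s}" "T e = {t}"
proof -
  have b: "fst e \<in> Bs" "e \<in> set (atB (fst e))" and w: "snd e \<in> Ws" "e \<in> set (atW (snd e))"
    using assms(3) D_edge by (auto simp: set_atB set_atW)
  from assms(1) b(1) two_valent_atB[OF b(1)]
  have S: "m e = 2 \<and> S e = {1, 2} \<or> m e = 1 \<and> (\<exists>s. S e = {s})"
    by (cases rule: half_coloring_cases) (use b(2) in auto)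
  from assms(2) w(1) two_valent_atW[OF w(1)]
  have T: "m e = 2 \<and> T e = {1, 2} \<or> m e = 1 \<and> (\<exists>t. T e = {t})"
    by (cases rule: half_coloring_cases) (use w(2) in auto)
  from S T that show thesis by auto
qed

text \<open>The trace becomes a sum over states of products of vertex factors. With one
  \<open>\<theta>\<close> per vertex, all factors are nonnegative, and the state that is
  \<open>True\<close> everywhere contributes a positive summand.\<close>

lemma web_trace_pos:
  assumes \<theta>: "\<theta> = 1 \<or> \<theta> = (-1::real)" and \<nu>: "\<And>i. \<nu> i = 1 \<or> \<nu> i = (-1::real)"
    and fact: "\<And>i r c. conn A B i $ r $ c = \<nu> i * (\<Sum>k\<in>UNIV. X i k $ r * Y i k $ c)"
    and Y: "\<And>i j k l. (i, j) \<in> black_pairs \<Longrightarrow> \<theta> * cross2 (Y i k) (Y j l) \<ge> 0"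
      "\<And>i j. (i, j) \<in> black_pairs \<Longrightarrow> \<theta> * cross2 (Y i True) (Y j True) > 0"
    and X: "\<And>i j k l. (i, j) \<in> white_pairs \<Longrightarrow> \<theta> * cross2 (X i k) (X j l) \<ge> 0"
      "\<And>i j. (i, j) \<in> white_pairs \<Longrightarrow> \<theta> * cross2 (X i True) (X j True) > 0"
    and det: "\<And>i. det (conn A B i) > 0"
  shows "web_trace Bs Ws E (\<lambda>_. 2) (\<lambda>_. 2) hc_ordB hc_ordW (hc_conn A B) m > 0"
proof -
  \<comment> \<open>Only simple edges are expanded into two terms; a double edge keeps its
    determinant as a single term.\<close>
  define K :: "(int \<times> int) \<times> (int \<times> int) \<Rightarrow> bool set" where
    "K e = (if m e = 1 then UNIV else {True})" for e
  \<comment> \<open>The factors \<theta> on edges of multiplicity two make also the vertices on such edges contribute the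
    sign \<theta>.\<close>
  define x where "x e k R = (if m e = 1 then X (etype e) k $ of_nat (the_elem R)
      else \<theta> * det (conn A B (etype e)))" for e k and R :: "nat set"
  define y where "y e k R = (if m e = 1 then Y (etype e) k $ of_nat (the_elem R) else \<theta>)"
    for e k and R :: "nat set"
  have minor: "minor_det (entries (conn A B (etype e))) (T e) (S e) =
      \<nu> (etype e) ^ m e * (\<Sum>k\<in>K e. x e k (T e) * y e k (S e))"
    if S: "S \<in> {S. half_coloring Bs atB m S}" and T: "T \<in> {T. half_coloring Ws atW m T}"
      and e: "e \<in> D" for S T e
  proof -
    from S T have "half_coloring Bs atB m S" "half_coloring Ws atW m T" by auto
    then show ?thesis using e
    proof (cases rule: half_coloring_at_D)
      case 1
      \<comment> \<open>On a double edge, \<open>\<nu>\<close> enters squared, and the two inserted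
        factors \<open>\<theta>\<close> cancel.\<close>
      have "\<nu> (etype e) ^ 2 = 1" "\<theta> * \<theta> = 1" using \<nu>[of "etype e"] \<theta> by auto
      moreover have "minor_det (entries (conn A B (etype e))) (T e) (S e) = det (conn A B (etype e))"
        by (simp only: 1(2,3) minor_det_full) (simp add: entries_def det_2)
      ultimately show ?thesis
        using 1(1) by (simp add: K_def x_def y_def)
    next
      case (2 s t)
      then show ?thesis
        by (simp add: minor_det_singleton K_def x_def y_def entries_def fact)
    qed
  qed
  define Z where "Z \<kappa> = (\<Prod>b\<in>Bs. \<theta> * local_sum (\<lambda>e. y e (\<kappa> e)) (atB b)) *
      (\<Prod>w\<in>Ws. \<theta> * local_sum (\<lambda>e. x e (\<kappa> e)) (atW w))" for \<kappa>
  have "web_trace Bs Ws E (\<lambda>_. 2) (\<lambda>_. 2) hc_ordB hc_ordW (hc_conn A B) m =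
      (\<Prod>e\<in>D. \<nu> (etype e) ^ m e) * (\<Sum>\<kappa>\<in>PiE D K.
        (\<Sum>S | half_coloring Bs atB m S.
          of_int (\<Prod>b\<in>Bs. list_sign S (atB b)) * (\<Prod>e\<in>D. y e (\<kappa> e) (S e))) *
        (\<Sum>T | half_coloring Ws atW m T.
          of_int (\<Prod>w\<in>Ws. list_sign T (atW w)) * (\<Prod>e\<in>D. x e (\<kappa> e) (T e))))"
    unfolding web_trace_eq
    by (rule sum_prod_bilinear) (use finD minor in \<open>auto simp: K_def\<close>)
  also have "\<dots> = (\<Sum>\<kappa>\<in>PiE D K.
      (\<Prod>b\<in>Bs. local_sum (\<lambda>e. y e (\<kappa> e)) (atB b)) * (\<Prod>w\<in>Ws. local_sum (\<lambda>e. x e (\<kappa> e)) (atW w)))"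
  proof -
    have "(\<Sum>S | half_coloring Bs atB m S.
          of_int (\<Prod>b\<in>Bs. list_sign S (atB b)) * (\<Prod>e\<in>D. y e (\<kappa> e) (S e))) =
        (\<Prod>b\<in>Bs. local_sum (\<lambda>e. y e (\<kappa> e)) (atB b))" for \<kappa>
      unfolding UN_atB[symmetric]
      by (rule sum_half_colorings[where own = fst]) (auto simp: finB set_atB two_valent_atB)
    moreover have "(\<Sum>T | half_coloring Ws atW m T.
          of_int (\<Prod>w\<in>Ws. list_sign T (atW w)) * (\<Prod>e\<in>D. x e (\<kappa> e) (T e))) =
        (\<Prod>w\<in>Ws. local_sum (\<lambda>e. x e (\<kappa> e)) (atW w))" for \<kappa>
      unfolding UN_atW[symmetric]
      by (rule sum_half_colorings[where own = snd]) (auto simp: finW set_atW two_valent_atW)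
    moreover have "(\<Prod>e\<in>D. \<nu> (etype e) ^ m e) = 1"
      using \<nu> by (rule prod_type_signs)
    ultimately show ?thesis by simp
  qed
  also have "\<dots> = (\<Sum>\<kappa>\<in>PiE D K. Z \<kappa>)"
  proof (intro sum.cong refl)
    fix \<kappa>
    \<comment> \<open>The equal numbers of black and white vertices make the total number of
      inserted signs even.\<close>
    have "\<theta> ^ card Bs * \<theta> ^ card Ws = 1"
      using \<theta> unfolding balanced by (auto simp flip: power_mult_distrib)
    then show "(\<Prod>b\<in>Bs. local_sum (\<lambda>e. y e (\<kappa> e)) (atB b)) *
        (\<Prod>w\<in>Ws. local_sum (\<lambda>e. x e (\<kappa> e)) (atW w)) = Z \<kappa>"
      unfolding Z_def by (simp add: prod.distrib mult_ac)
  qed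
  also have "\<dots> > 0"
  proof -
    have \<theta>2: "\<theta> * \<theta> = 1" using \<theta> by auto
    have locB: "\<theta> * local_sum (\<lambda>e. y e (\<kappa> e)) (atB b) \<ge> 0 \<and>
        ((\<forall>e\<in>D. \<kappa> e) \<longrightarrow> \<theta> * local_sum (\<lambda>e. y e (\<kappa> e)) (atB b) > 0)" if b: "b \<in> Bs" for b \<kappa>
    proof -
      from two_valent_atB[OF b] consider e where "atB b = [e]" "m e = 2"
        | e f where "atB b = [e, f]" "m e = 1" "m f = 1"
        by (auto simp: two_valent_def)
      then show ?thesis
      proof cases
        case 1
        then show ?thesis using \<theta>2 by (simp add: y_def)
      next
        case 2
        have "e \<in> D" "f \<in> D" using set_atB[of b] 2 by auto
        \<comment> \<open>The two ways to distribute the colours, with their signs, form the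
          determinant of the two selected vectors; the cilium fixes their order, so \<open>Y\<close>
          determines its sign.\<close>
        moreover have "local_sum (\<lambda>e. y e (\<kappa> e)) (atB b) =
            cross2 (Y (etype e) (\<kappa> e)) (Y (etype f) (\<kappa> f))"
          using 2 by (simp add: y_def cross2_def)
        ultimately show ?thesis using Y atB_pair[OF 2(1)] by auto
      qed
    qed
    have locW: "\<theta> * local_sum (\<lambda>e. x e (\<kappa> e)) (atW w) \<ge> 0 \<and>
        ((\<forall>e\<in>D. \<kappa> e) \<longrightarrow> \<theta> * local_sum (\<lambda>e. x e (\<kappa> e)) (atW w) > 0)" if w: "w \<in> Ws" for w \<kappa>
    proof -
      from two_valent_atW[OF w] consider e where "atW w = [e]" "m e = 2"
        | e f where "atW w = [e, f]" "m e = 1" "m f = 1"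
        by (auto simp: two_valent_def)
      then show ?thesis
      proof cases
        case 1
        then show ?thesis using \<theta>2 det[of "etype e"] by (simp add: x_def flip: mult.assoc)
      next
        case 2
        have "e \<in> D" "f \<in> D" using set_atW[of w] 2 by auto
        moreover have "local_sum (\<lambda>e. x e (\<kappa> e)) (atW w) =
            cross2 (X (etype e) (\<kappa> e)) (X (etype f) (\<kappa> f))"
          using 2 by (simp add: x_def cross2_def)
        ultimately show ?thesis using X atW_pair[OF 2(1)] by auto
      qed
    qed
    have "finite (PiE D K)" using finD by (intro finite_PiE) (auto simp: K_def)
    moreover have "(\<lambda>e\<in>D. True) \<in> PiE D K" by (auto simp: K_def)
    moreover have "Z (\<lambda>e\<in>D. True) > 0"
      unfolding Z_def 
      by (rule mult_pos_pos[OF prod_pos prod_pos];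
          rule locB[THEN conjunct2, THEN mp] locW[THEN conjunct2, THEN mp]; simp)
    moreover have "Z \<kappa> \<ge> 0" for \<kappa>
      unfolding Z_def 
      by (rule mult_nonneg_nonneg[OF prod_nonneg prod_nonneg];
          rule locB[THEN conjunct1] locW[THEN conjunct1]; assumption)
    ultimately show ?thesis by (intro sum_pos2[where i = "\<lambda>e\<in>D. True"])
  qed
  finally show ?thesis .
qed

end

theorem theorem6:
  fixes A B :: "real^2^2"
  assumes "invertible A" and "invertible B"
    and "(eigs_real_pos A \<and> eigs_real_pos B \<and> eigs_real_neg (A ** matrix_inv B)) \<or>
         (eigs_real_pos A \<and> eigs_real_neg B \<and> eigs_real_pos (A ** matrix_inv B)) \<or>
         (eigs_real_neg A \<and> eigs_real_pos B \<and> eigs_real_pos (A ** matrix_inv B)) \<or>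
         (eigs_real_neg A \<and> eigs_real_neg B \<and> eigs_real_neg (A ** matrix_inv B))"
  shows "\<forall>(Bs :: (int \<times> int) set) (Ws :: (int \<times> int) set) E m.
           finite Bs \<and> finite Ws \<and> card Bs = card Ws \<and>
           E \<subseteq> {e. hc_edge e \<and> fst e \<in> Bs \<and> snd e \<in> Ws} \<and>
           multiweb Bs Ws E (\<lambda>_. 2) (\<lambda>_. 2) m
           \<longrightarrow> web_trace Bs Ws E (\<lambda>_. 2) (\<lambda>_. 2) hc_ordB hc_ordW (hc_conn A B) m > 0"
proof -
  \<comment> \<open>All four cases of the hypothesis say that the three eigenvalue signs have
    negative product.\<close>
  have "\<exists>sA sB sC. eigs_signed sA A \<and> eigs_signed sB B \<and> eigs_signed sC (A ** matrix_inv B) \<and>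
      sA * sB * sC < 0"
    using assms(3)
  proof (elim disjE conjE)
    assume "eigs_real_pos A" "eigs_real_pos B" "eigs_real_neg (A ** matrix_inv B)"
    then show ?thesis
      by (intro exI[of _ 1] exI[of _ "-1"]) (simp add: eigs_signed_of_pos eigs_signed_of_neg)
  next
    assume "eigs_real_pos A" "eigs_real_neg B" "eigs_real_pos (A ** matrix_inv B)"
    then show ?thesis
      by (intro exI[of _ 1] exI[of _ "-1"] exI[of _ 1])
        (simp add: eigs_signed_of_pos eigs_signed_of_neg)
  next
    assume "eigs_real_neg A" "eigs_real_pos B" "eigs_real_pos (A ** matrix_inv B)"
    then show ?thesis
      by (intro exI[of _ "-1"] exI[of _ 1]) (simp add: eigs_signed_of_pos eigs_signed_of_neg)
  next
    assume "eigs_real_neg A" "eigs_real_neg B" "eigs_real_neg (A ** matrix_inv B)"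
    then show ?thesis
      by (intro exI[of _ "-1"]) (simp add: eigs_signed_of_neg)
  qed
  then obtain sA sB sC where s: "eigs_signed sA A" "eigs_signed sB B"
      "eigs_signed sC (A ** matrix_inv B)" "sA * sB * sC < 0"
    by blast
  have det: "det (conn A B i) > 0" for i
    using s by (cases i) (auto simp: eigs_signed_def)
  show ?thesis
  proof (intro allI impI, elim conjE)
    fix Bs Ws :: "(int \<times> int) set" and E m
    assume "finite Bs" "finite Ws" "card Bs = card Ws"
      "E \<subseteq> {e. hc_edge e \<and> fst e \<in> Bs \<and> snd e \<in> Ws}" "multiweb Bs Ws E (\<lambda>_. 2) (\<lambda>_. 2) m"
    then interpret honeycomb_web Bs Ws E m by unfold_locales
    show "web_trace Bs Ws E (\<lambda>_. 2) (\<lambda>_. 2) hc_ordB hc_ordW (hc_conn A B) m > 0"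
      by (rule conn_factorization[OF assms(2) s]) (rule web_trace_pos; (assumption | rule det))
  qed
qed

end
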